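(* Consider the second order linear (BDF2) scheme described in the context. It is unconditionally energy stable: for every time step $\delta t>0$ (with no restriction on its size), whenever $(\tilde{\boldsymbol u},\boldsymbol u,\phi,\mu_\phi,\rho,\mu_\rho,U,V,W,p)^{n+1}$ is obtained from the two previous time levels $n-1$ and $n$ by the scheme, the following discrete energy dissipation law holds: $$\frac{1}{\delta t}\big(E_{2nd}^{n+1,n}-E_{2nd}^{n,n-1}\big)\le-\nu\|\nabla\tilde{\boldsymbol u}^{n+1}\|^2-M_1\|\nabla\mu_\phi^{n+1}\|^2-M_2\|\nabla\mu_\rho^{n+1}\|^2,$$ where $$\begin{aligned}E_{2nd}^{n+1,n}=&\ \frac12\Big(\frac12\|\boldsymbol u^{n+1}\|^2+\frac12\|2\boldsymbol u^{n+1}-\boldsymbol u^n\|^2\Big)+\frac{\delta t^2}{3}\|\nabla p^{n+1}\|^2\\&+\frac\epsilon2\Big(\frac12\|\nabla\phi^{n+1}\|^2+\frac12\|2\nabla\phi^{n+1}-\nabla\phi^n\|^2\Big)+\frac\eta2\Big(\frac12\|\nabla\rho^{n+1}\|^2+\frac12\|2\nabla\rho^{n+1}-\nabla\rho^n\|^2\Big)\\&+\frac1{4\epsilon}\Big(\frac12\|U^{n+1}\|^2+\frac12\|2U^{n+1}-U^n\|^2\Big)+\frac\alpha2\Big(\frac12\|V^{n+1}\|^2+\frac12\|2V^{n+1}-V^n\|^2\Big)\\&+\beta\Big(\frac12\|W^{n+1}\|^2+\frac12\|2W^{n+1}-W^n\|^2\Big),\end{aligned}$$ and $E_{2nd}^{n,n-1}$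 is the same expression with $n+1,n$ replaced by $n,n-1$ respectively.
   Context: Domain and spaces. $\Omega\subset\mathbb R^d$, $d=2$ or $3$, is a rectangular box and all functions are $\Omega$-periodic (periodic boundary conditions for all variables). $(f,g)=\int_\Omega fg\,d\boldsymbol x$ (with the obvious version for vector and matrix fields), $\|f\|^2=(f,f)$. $H^1_{per}(\Omega)$ is the space of periodic $H^1(\Omega)$ functions and $H^1_{\boldsymbol u}(\Omega)=[H^1_{per}(\Omega)]^d$. Parameters. $\nu,M_1,M_2,\epsilon,\eta,\alpha,\beta>0$ are constants. For fixed small $\widehat\epsilon\in(0,1/2)$, $G:\mathbb R\to\mathbb R$ is the regularized Flory–Huggins potential $$G(\rho)=\begin{cases}\rho\ln\rho+\frac{(1-\rho)^2}{2\widehat\epsilon}+(1-\rho)\ln\widehat\epsilon-\frac{\widehat\epsilon}{2},&\rho\ge 1-\widehat\epsilon,\\ \rho\ln\rho+(1-\rho)\ln(1-\rho),&\widehat\epsilon\le\rho\le1-\widehat\epsilon,\\ (1-\rho)\ln(1-\rho)+\frac{\rho^2}{2\widehat\epsilon}+\rho\ln\widehat\epsilon-\frac{\widehat\epsilon}{2},&\rho\le\widehat\epsilon,\end{cases}$$ $A>0$ is a constant such that $G+A>0$ on $\mathbb R$, and $H(\rho)=G'(\rho)/\sqrt{G(\rho)+A}$. For $\phi\in H^1_{per}(\Omega)$, $\boldsymbol Z(\phi)=\nabla\phi/|\nabla\phi|$ (with $\boldsymbol Z(\phi)=0$ where $\nabla\phi=0$). Also $B(\boldsymbol u,\boldsymbol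 v)=(\boldsymbol u\cdot\nabla)\boldsymbol v+\frac12(\nabla\cdot\boldsymbol u)\boldsymbol v$. The scheme. Let $n\ge1$ and suppose that $(\boldsymbol u,\phi,\rho,U,V,W)^{n-1}$, $(\boldsymbol u,\phi,\rho,U,V,W)^n$ and $p^n$ are known, with $\nabla\cdot\boldsymbol u^{n-1}=\nabla\cdot\boldsymbol u^n=0$. Set $\boldsymbol u^\star=2\boldsymbol u^n-\boldsymbol u^{n-1}$, $\phi^\star=2\phi^n-\phi^{n-1}$, $\rho^\star=2\rho^n-\rho^{n-1}$, $\boldsymbol Z^\star=\boldsymbol Z(\phi^\star)$, $H^\star=H(\rho^\star)$. Step 1: find $(\tilde{\boldsymbol u},\phi,\mu_\phi,\rho,\mu_\rho,U,V,W)^{n+1}$ such that $$\frac{3\tilde{\boldsymbol u}^{n+1}-4\boldsymbol u^n+\boldsymbol u^{n-1}}{2\delta t}+B(\boldsymbol u^\star,\tilde{\boldsymbol u}^{n+1})-\nu\Delta\tilde{\boldsymbol u}^{n+1}+\nabla p^n+\phi^\star\nabla\mu_\phi^{n+1}+\rho^\star\nabla\mu_\rho^{n+1}=0,$$ $$\frac{3\phi^{n+1}-4\phi^n+\phi^{n-1}}{2\delta t}+\nabla\cdot(\tilde{\boldsymbol u}^{n+1}\phi^\star)=M_1\Delta\mu_\phi^{n+1},$$ $$\mu_\phi^{n+1}=-\epsilon\Delta\phi^{n+1}+\frac1\epsilon\phi^\star U^{n+1}+\alpha\nabla\cdot(V^{n+1}\boldsymbol Z^\star),$$ $$\frac{3\rho^{n+1}-4\rho^n+\rho^{n-1}}{2\delta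 t}+\nabla\cdot(\tilde{\boldsymbol u}^{n+1}\rho^\star)=M_2\Delta\mu_\rho^{n+1},$$ $$\mu_\rho^{n+1}=-\eta\Delta\rho^{n+1}+\alpha V^{n+1}+\beta H^\star W^{n+1},$$ $$3U^{n+1}-4U^n+U^{n-1}=2\phi^\star(3\phi^{n+1}-4\phi^n+\phi^{n-1}),$$ $$3V^{n+1}-4V^n+V^{n-1}=(3\rho^{n+1}-4\rho^n+\rho^{n-1})-\boldsymbol Z^\star\cdot\nabla(3\phi^{n+1}-4\phi^n+\phi^{n-1}),$$ $$3W^{n+1}-4W^n+W^{n-1}=\tfrac12H^\star(3\rho^{n+1}-4\rho^n+\rho^{n-1}).$$ Step 2: find $(\boldsymbol u^{n+1},p^{n+1})$ such that $$\frac{3}{2\delta t}(\boldsymbol u^{n+1}-\tilde{\boldsymbol u}^{n+1})+\nabla(p^{n+1}-p^n)=0,\qquad\nabla\cdot\boldsymbol u^{n+1}=0.$$ Function classes: at every time level $\boldsymbol u,\tilde{\boldsymbol u}\in H^1_{\boldsymbol u}(\Omega)$; $\phi,\rho,\mu_\phi,\mu_\rho,p\in H^1_{per}(\Omega)$; $U,V,W$ are periodic $L^2(\Omega)$ functions. The first five equations of Step 1 are understood in the weak sense (tested against arbitrary periodic $H^1$ functions, with the terms involving $\Delta$ and $\nabla\cdot$ integrated by parts); the remaining equations hold almost everywhere. *)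

theory Defs
  imports "HOL-Analysis.Analysis"
begin

text \<open>
  The domain is the box with corners \<open>a\<close> and \<open>b\<close>. Elements of the function spaces are
  everywhere defined, periodic representatives on the whole space; integrals are over the box.
\<close>

definition periodic :: "real^'d \<Rightarrow> real^'d \<Rightarrow> (real^'d \<Rightarrow> 'e) \<Rightarrow> bool" where
  "periodic a b f \<longleftrightarrow> (\<forall>x i. f (x + (b $ i - a $ i) *\<^sub>R axis i 1) = f x)"

text \<open>
  One inner product serves scalar, vector and matrix fields, since \<open>\<bullet>\<close> on \<open>real\<close> is
  multiplication and on \<open>real^'d^'d\<close> is the Frobenius product.
\<close>

definition ip :: "real^'d \<Rightarrow> real^'d \<Rightarrow> (real^'d \<Rightarrow> 'e::real_inner) \<Rightarrow> (real^'d \<Rightarrow> 'e) \<Rightarrow> real" where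
  "ip a b f g = (LINT x|lebesgue_on (box a b). f x \<bullet> g x)"

definition nsq :: "real^'d \<Rightarrow> real^'d \<Rightarrow> (real^'d \<Rightarrow> 'e::real_inner) \<Rightarrow> real" where
  "nsq a b f = ip a b f f"

definition L2per :: "real^'d \<Rightarrow> real^'d \<Rightarrow> (real^'d \<Rightarrow> 'e::euclidean_space) set" where
  "L2per a b = {f. f \<in> borel_measurable lebesgue \<and> periodic a b f
                 \<and> integrable (lebesgue_on (box a b)) (\<lambda>x. f x \<bullet> f x)}"

definition pderiv :: "'d \<Rightarrow> (real^'d \<Rightarrow> real) \<Rightarrow> real^'d \<Rightarrow> real" where
  "pderiv i f x = frechet_derivative f (at x) (axis i 1)"

primrec Ck :: "nat \<Rightarrow> (real^'d \<Rightarrow> real) \<Rightarrow> bool" where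
  "Ck 0 f = continuous_on UNIV f"
| "Ck (Suc k) f = ((\<forall>x. f differentiable (at x)) \<and> (\<forall>i. Ck k (pderiv i f)))"

definition Cinf_per :: "real^'d \<Rightarrow> real^'d \<Rightarrow> (real^'d \<Rightarrow> real) set" where
  "Cinf_per a b = {f. periodic a b f \<and> (\<forall>k. Ck k f)}"

text \<open>
  Weak derivatives are those of periodic distributions: the test functions are smooth and
  periodic rather than compactly supported in the box, so a jump of \<open>f\<close> across opposite faces
  of the box is not overlooked.
\<close>

definition has_weak_grad ::
  "real^'d \<Rightarrow> real^'d \<Rightarrow> (real^'d \<Rightarrow> real) \<Rightarrow> (real^'d \<Rightarrow> real^'d) \<Rightarrow> bool" where
  "has_weak_grad a b f g \<longleftrightarrow> g \<in> L2per a b \<and>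
     (\<forall>\<psi>\<in>Cinf_per a b. \<forall>i. ip a b f (pderiv i \<psi>) = - ip a b (\<lambda>x. g x $ i) \<psi>)"

definition H1per :: "real^'d \<Rightarrow> real^'d \<Rightarrow> (real^'d \<Rightarrow> real) set" where
  "H1per a b = {f \<in> L2per a b. \<exists>g. has_weak_grad a b f g}"

definition H1u :: "real^'d \<Rightarrow> real^'d \<Rightarrow> (real^'d \<Rightarrow> real^'d) set" where
  "H1u a b = {v. \<forall>i. (\<lambda>x. v x $ i) \<in> H1per a b}"

text \<open>
  The weak gradient is unique only up to null sets; \<open>grad\<close> picks one representative, and is
  only ever used under an integral or an almost-everywhere quantifier.
\<close>

definition grad :: "real^'d \<Rightarrow> real^'d \<Rightarrow> (real^'d \<Rightarrow> real) \<Rightarrow> real^'d \<Rightarrow> real^'d" where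
  "grad a b f = (SOME g. has_weak_grad a b f g)"

text \<open>Row \<open>i\<close> of \<open>jac\<close> is the gradient of the \<open>i\<close>-th component.\<close>

definition jac :: "real^'d \<Rightarrow> real^'d \<Rightarrow> (real^'d \<Rightarrow> real^'d) \<Rightarrow> real^'d \<Rightarrow> real^'d^'d" where
  "jac a b v x = (\<chi> i. grad a b (\<lambda>y. v y $ i) x)"

definition dvg :: "real^'d \<Rightarrow> real^'d \<Rightarrow> (real^'d \<Rightarrow> real^'d) \<Rightarrow> real^'d \<Rightarrow> real" where
  "dvg a b v x = (\<Sum>i\<in>UNIV. jac a b v x $ i $ i)"

definition convB ::
  "real^'d \<Rightarrow> real^'d \<Rightarrow> (real^'d \<Rightarrow> real^'d) \<Rightarrow> (real^'d \<Rightarrow> real^'d) \<Rightarrow> real^'d \<Rightarrow> real^'d" where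
  "convB a b u v x = jac a b v x *v u x + (1/2 * dvg a b u x) *\<^sub>R v x"

definition unit_grad :: "real^'d \<Rightarrow> real^'d \<Rightarrow> (real^'d \<Rightarrow> real) \<Rightarrow> real^'d \<Rightarrow> real^'d" where
  "unit_grad a b f x =
     (if grad a b f x = 0 then 0 else (1 / norm (grad a b f x)) *\<^sub>R grad a b f x)"

text \<open>The branches of the regularised potential agree at the two interface points.\<close>

definition FH :: "real \<Rightarrow> real \<Rightarrow> real" where
  "FH \<epsilon>h r =
     (if r \<ge> 1 - \<epsilon>h then r * ln r + (1 - r)\<^sup>2 / (2 * \<epsilon>h) + (1 - r) * ln \<epsilon>h - \<epsilon>h / 2
      else if r \<ge> \<epsilon>h then r * ln r + (1 - r) * ln (1 - r)
      else (1 - r) * ln (1 - r) + r\<^sup>2 / (2 * \<epsilon>h) + r * ln \<epsilon>h - \<epsilon>h / 2)"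

definition Hfun :: "real \<Rightarrow> real \<Rightarrow> real \<Rightarrow> real" where
  "Hfun \<epsilon>h A r = deriv (FH \<epsilon>h) r / sqrt (FH \<epsilon>h r + A)"

definition extrap :: "(real^'d \<Rightarrow> 'e::real_vector) \<Rightarrow> (real^'d \<Rightarrow> 'e) \<Rightarrow> real^'d \<Rightarrow> 'e" where
  "extrap f g x = 2 *\<^sub>R f x - g x"

definition bdf :: "(real^'d \<Rightarrow> 'e::real_vector) \<Rightarrow> (real^'d \<Rightarrow> 'e) \<Rightarrow> (real^'d \<Rightarrow> 'e) \<Rightarrow> real^'d \<Rightarrow> 'e" where
  "bdf f g h x = 3 *\<^sub>R f x - 4 *\<^sub>R g x + h x"

text \<open>
  In the weak equations every term is a separate integral. For the functions admitted in
  dimension 2 or 3 all these integrals converge (\<open>H\<^sup>1\<close> embeds into \<open>L\<^sup>6\<close>, and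
  \<open>unit_grad\<close> and \<open>Hfun\<close> are bounded), so the value 0 that the library assigns to the integral
  of a non-integrable function does not occur.

  The arguments \<open>us\<close>, \<open>\<phi>s\<close>, \<open>\<rho>s\<close>, \<open>Zs\<close>, \<open>Hs\<close> are the starred quantities, \<open>ut\<close> is the
  intermediate velocity at level \<open>n+1\<close>.
\<close>

definition momentum_eq where
  "momentum_eq a b \<nu> \<delta>t us \<phi>s \<rho>s ut u1 u0 p1 \<mu>\<phi> \<mu>\<rho> \<longleftrightarrow>
     (\<forall>v\<in>H1u a b.
        ip a b (\<lambda>x. (1 / (2 * \<delta>t)) *\<^sub>R bdf ut u1 u0 x) v
      + ip a b (convB a b us ut) v
      + \<nu> * ip a b (jac a b ut) (jac a b v)
      + ip a b (grad a b p1) v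
      + ip a b (\<lambda>x. \<phi>s x *\<^sub>R grad a b \<mu>\<phi> x) v
      + ip a b (\<lambda>x. \<rho>s x *\<^sub>R grad a b \<mu>\<rho> x) v = 0)"

definition transport_eq where
  "transport_eq a b M \<delta>t ut fs f2 f1 f0 \<mu> \<longleftrightarrow>
     (\<forall>\<psi>\<in>H1per a b.
        ip a b (\<lambda>x. bdf f2 f1 f0 x / (2 * \<delta>t)) \<psi>
      - ip a b (\<lambda>x. fs x *\<^sub>R ut x) (grad a b \<psi>)
      = - (M * ip a b (grad a b \<mu>) (grad a b \<psi>)))"

definition mu_phi_eq where
  "mu_phi_eq a b \<epsilon> \<alpha> \<phi>s Zs \<mu>\<phi> \<phi>2 U2 V2 \<longleftrightarrow>
     (\<forall>\<psi>\<in>H1per a b.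
        ip a b \<mu>\<phi> \<psi>
      = \<epsilon> * ip a b (grad a b \<phi>2) (grad a b \<psi>)
      + 1 / \<epsilon> * ip a b (\<lambda>x. \<phi>s x * U2 x) \<psi>
      - \<alpha> * ip a b (\<lambda>x. V2 x *\<^sub>R Zs x) (grad a b \<psi>))"

definition mu_rho_eq where
  "mu_rho_eq a b \<eta> \<alpha> \<beta> Hs \<mu>\<rho> \<rho>2 V2 W2 \<longleftrightarrow>
     (\<forall>\<psi>\<in>H1per a b.
        ip a b \<mu>\<rho> \<psi>
      = \<eta> * ip a b (grad a b \<rho>2) (grad a b \<psi>)
      + \<alpha> * ip a b V2 \<psi>
      + \<beta> * ip a b (\<lambda>x. Hs x * W2 x) \<psi>)"

definition bdf2_step1 where
  "bdf2_step1 a b \<nu> M1 M2 \<epsilon> \<eta> \<alpha> \<beta> \<epsilon>h A \<delta>t n u p \<phi> \<rho> U V W ut \<mu>\<phi> \<mu>\<rho> \<longleftrightarrow>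
     (let us = extrap (u n) (u (n - 1));
          \<phi>s = extrap (\<phi> n) (\<phi> (n - 1));
          \<rho>s = extrap (\<rho> n) (\<rho> (n - 1));
          Zs = unit_grad a b \<phi>s;
          Hs = (\<lambda>x. Hfun \<epsilon>h A (\<rho>s x));
          d\<phi> = bdf (\<phi> (n + 1)) (\<phi> n) (\<phi> (n - 1));
          d\<rho> = bdf (\<rho> (n + 1)) (\<rho> n) (\<rho> (n - 1))
      in momentum_eq a b \<nu> \<delta>t us \<phi>s \<rho>s ut (u n) (u (n - 1)) (p n) \<mu>\<phi> \<mu>\<rho>
       \<and> transport_eq a b M1 \<delta>t ut \<phi>s (\<phi> (n + 1)) (\<phi> n) (\<phi> (n - 1)) \<mu>\<phi>
       \<and> mu_phi_eq a b \<epsilon> \<alpha> \<phi>s Zs \<mu>\<phi> (\<phi> (n + 1)) (U (n + 1)) (V (n + 1))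
       \<and> transport_eq a b M2 \<delta>t ut \<rho>s (\<rho> (n + 1)) (\<rho> n) (\<rho> (n - 1)) \<mu>\<rho>
       \<and> mu_rho_eq a b \<eta> \<alpha> \<beta> Hs \<mu>\<rho> (\<rho> (n + 1)) (V (n + 1)) (W (n + 1))
       \<and> (AE x in lebesgue_on (box a b).
            bdf (U (n + 1)) (U n) (U (n - 1)) x = 2 * \<phi>s x * d\<phi> x)
       \<and> (AE x in lebesgue_on (box a b).
            bdf (V (n + 1)) (V n) (V (n - 1)) x = d\<rho> x - Zs x \<bullet> grad a b d\<phi> x)
       \<and> (AE x in lebesgue_on (box a b).
            bdf (W (n + 1)) (W n) (W (n - 1)) x = 1/2 * Hs x * d\<rho> x))"

definition bdf2_step2 where
  "bdf2_step2 a b \<delta>t n u p ut \<longleftrightarrow>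
     (AE x in lebesgue_on (box a b).
        (3 / (2 * \<delta>t)) *\<^sub>R (u (n + 1) x - ut x)
        + grad a b (\<lambda>y. p (n + 1) y - p n y) x = 0)
   \<and> (AE x in lebesgue_on (box a b). dvg a b (u (n + 1)) x = 0)"

definition avg_sq where
  "avg_sq a b f g = 1/2 * nsq a b f + 1/2 * nsq a b (extrap f g)"

definition E2nd where
  "E2nd a b \<epsilon> \<eta> \<alpha> \<beta> \<delta>t u p \<phi> \<rho> U V W (m::nat) k =
      1/2 * avg_sq a b (u m) (u k) + \<delta>t\<^sup>2 / 3 * nsq a b (grad a b (p m))
    + \<epsilon> / 2 * avg_sq a b (grad a b (\<phi> m)) (grad a b (\<phi> k))
    + \<eta> / 2 * avg_sq a b (grad a b (\<rho> m)) (grad a b (\<rho> k))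
    + 1 / (4 * \<epsilon>) * avg_sq a b (U m) (U k)
    + \<alpha> / 2 * avg_sq a b (V m) (V k)
    + \<beta> * avg_sq a b (W m) (W k)"

end

theory Submission
  imports Defs "HOL-Real_Asymp.Real_Asymp"
begin

text \<open>
  The dissipation law is obtained by testing the momentum equation with the intermediate velocity,
  the two transport equations with the chemical potentials, and the two equations for the chemical
  potentials with the discrete time differences of the phase variable and of the density. The
  coupling terms
  \<open>\<phi>s *\<^sub>R grad \<mu>\<phi>\<close> and \<open>\<rho>s *\<^sub>R grad \<mu>\<rho>\<close>, paired with the intermediate velocity, occur once in the
  momentum equation and once, with the opposite sign, in a transport equation, so they cancel
  identically. The updates of \<open>U\<close>, \<open>V\<close> and \<open>W\<close> turn the nonlinear terms into the products
  \<open>bdf U \<bullet> U\<close>, \<open>bdf V \<bullet> V\<close> and \<open>bdf W \<bullet> W\<close> (\<open>chemical_potentials_tested\<close>), and each product of this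
  form dominates the increment of a quadratic energy, because the backward difference formula is
  G-stable (\<open>avg_sq_diff_le\<close>). The projection step costs nothing but the increment of the pressure
  gradient, as divergence free fields are orthogonal to gradients
  (\<open>pressure_correction_energy\<close>).

  What is left is analysis at \<open>H\<^sup>1\<close> regularity: weak gradients are unique and hence linear almost
  everywhere, divergence free fields are orthogonal to gradients, and the convection term vanishes
  when tested with the transported field (\<open>convection_skew\<close>). All three follow from one density
  theorem (\<open>trig_poly_dense_H1\<close>): a function with a weak gradient is approximated, together with
  that gradient, by trigonometric polynomials. Density in \<open>L\<^sup>2\<close> comes from Stone-Weierstrass on the
  torus. It lifts to \<open>H\<^sup>1\<close> by orthogonal projection onto the span of finitely many Fourier modes:
  such a span is invariant under partial derivatives, and these are skew symmetric on it, so the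
  derivative of the projection of \<open>f\<close> is the projection of the weak derivative of \<open>f\<close>.

  For the convection term, the integral of \<open>v \<bullet> grad \<psi>\<close> vanishes for every divergence free \<open>v\<close> and
  every smooth \<open>\<psi>\<close>. With \<open>\<psi> = 1 / (1 + c * (w \<bullet> w))\<close>, which is bounded together with the relevant
  coefficients even if \<open>w\<close> is not, this gives the claim with a damping factor, and \<open>c \<rightarrow> 0\<close> removes
  the factor by dominated convergence.
\<close>

section \<open>Square integrable functions\<close>

definition sq_int :: "'a measure \<Rightarrow> ('a \<Rightarrow> 'e::euclidean_space) \<Rightarrow> bool" where
  "sq_int M f \<longleftrightarrow> f \<in> borel_measurable M \<and> integrable M (\<lambda>x. f x \<bullet> f x)"

lemma sq_int_measurable [measurable_dest]: "sq_int M f \<Longrightarrow> f \<in> borel_measurable M"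
  by (simp add: sq_int_def)

lemma sq_int_square: "sq_int M f \<Longrightarrow> integrable M (\<lambda>x. f x \<bullet> f x)"
  by (simp add: sq_int_def)

lemma abs_inner_le_sum_squares: "\<bar>x \<bullet> y\<bar> \<le> x \<bullet> x + y \<bullet> (y::'e::real_inner)"
proof -
  have "0 \<le> (x - y) \<bullet> (x - y)" "0 \<le> (x + y) \<bullet> (x + y)" "0 \<le> x \<bullet> x" "0 \<le> y \<bullet> y"
    by (rule inner_ge_zero)+
  then show ?thesis
    unfolding inner_diff_left inner_diff_right inner_add_left inner_add_right inner_commute[of y x]
    by linarith
qed

lemma sq_int_inner:
  assumes "sq_int M f" "sq_int M g"
  shows "integrable M (\<lambda>x. f x \<bullet> g x)"
proof (rule Bochner_Integration.integrable_bound)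
  show "integrable M (\<lambda>x. f x \<bullet> f x + g x \<bullet> g x)"
    using assms by (simp add: sq_int_def)
  show "(\<lambda>x. f x \<bullet> g x) \<in> borel_measurable M"
    using assms by (auto simp: sq_int_def)
  show "AE x in M. norm (f x \<bullet> g x) \<le> norm (f x \<bullet> f x + g x \<bullet> g x)"
    using abs_inner_le_sum_squares by (auto simp: add_nonneg_nonneg)
qed

lemma sq_int_dominated:
  assumes "f \<in> borel_measurable M" "sq_int M g" "AE x in M. norm (f x) \<le> C * norm (g x)"
  shows "sq_int M f"
  unfolding sq_int_def
proof (intro conjI assms(1), rule Bochner_Integration.integrable_bound)
  show "integrable M (\<lambda>x. C\<^sup>2 * (g x \<bullet> g x))"
    using assms(2) by (simp add: sq_int_def)
  show "(\<lambda>x. f x \<bullet> f x) \<in> borel_measurable M"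
    using assms(1) by simp
  show "AE x in M. norm (f x \<bullet> f x) \<le> norm (C\<^sup>2 * (g x \<bullet> g x))"
    using assms(3)
  proof eventually_elim
    case (elim x)
    then have "(norm (f x))\<^sup>2 \<le> (C * norm (g x))\<^sup>2"
      by (intro power_mono) auto
    then show ?case
      by (simp add: dot_square_norm power_mult_distrib)
  qed
qed

lemma sq_int_scaleR [intro]: "sq_int M f \<Longrightarrow> sq_int M (\<lambda>x. c *\<^sub>R f x)"
  by (rule sq_int_dominated[where g = f and C = "\<bar>c\<bar>"]) auto

lemma sq_int_mult [intro]: "sq_int M f \<Longrightarrow> sq_int M (\<lambda>x. c * f x)" for f :: "'a \<Rightarrow> real"
  using sq_int_scaleR[of M f c] by simp

lemma sq_int_add [intro]:
  assumes "sq_int M f" "sq_int M g"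
  shows "sq_int M (\<lambda>x. f x + g x)"
proof -
  have "integrable M (\<lambda>x. f x \<bullet> f x + 2 * (f x \<bullet> g x) + g x \<bullet> g x)"
    using assms sq_int_inner[OF assms] by (simp add: sq_int_def)
  then have "integrable M (\<lambda>x. (f x + g x) \<bullet> (f x + g x))"
    by (simp add: inner_add_left inner_add_right inner_commute algebra_simps)
  then show ?thesis
    using assms unfolding sq_int_def by (auto intro: borel_measurable_add)
qed

lemma sq_int_diff [intro]: "sq_int M f \<Longrightarrow> sq_int M g \<Longrightarrow> sq_int M (\<lambda>x. f x - g x)"
  using sq_int_add[of M f "\<lambda>x. (-1) *\<^sub>R g x"] sq_int_scaleR[of M g "-1"] by simp

lemma sq_int_zero [simp]: "sq_int M (\<lambda>x. 0)"
  by (simp add: sq_int_def)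

lemma sq_int_vec_nth:
  fixes f :: "'a \<Rightarrow> real^'n"
  shows "sq_int M f \<Longrightarrow> sq_int M (\<lambda>x. f x $ i)"
  by (rule sq_int_dominated[where g = f and C = 1])
     (auto simp: component_le_norm_cart sq_int_def
           intro!: borel_measurable_continuous_on[where f = "\<lambda>y. y $ i"] continuous_intros)

lemma sq_int_vecI:
  fixes f :: "'a \<Rightarrow> real^'n"
  assumes "\<And>i. sq_int M (\<lambda>x. f x $ i)"
  shows "sq_int M f"
  unfolding sq_int_def
proof
  have [measurable]: "(\<lambda>x. f x $ i) \<in> borel_measurable M" for i
    using assms by (simp add: sq_int_def)
  show "f \<in> borel_measurable M"
    by (subst borel_measurable_euclidean_space) (auto simp: Basis_vec_def inner_axis)
  show "integrable M (\<lambda>x. f x \<bullet> f x)"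
    using assms by (simp add: inner_vec_def sq_int_def)
qed

text \<open>
  The Cauchy-Schwarz inequality, in squared form. The integral of \<open>\<bar>s f - t g\<bar>\<^sup>2\<close> is a nonnegative
  quadratic form in \<open>s\<close> and \<open>t\<close>, which is evaluated where it forces the bound on the mixed term.
\<close>

lemma inner_integral_square_le:
  assumes "sq_int M f" "sq_int M g"
  shows "(LINT x|M. f x \<bullet> g x)\<^sup>2 \<le> (LINT x|M. f x \<bullet> f x) * (LINT x|M. g x \<bullet> g x)"
proof -
  let ?F = "LINT x|M. f x \<bullet> f x" and ?G = "LINT x|M. g x \<bullet> g x" and ?H = "LINT x|M. f x \<bullet> g x"
  have int: "integrable M (\<lambda>x. f x \<bullet> f x)" "integrable M (\<lambda>x. g x \<bullet> g x)"
    "integrable M (\<lambda>x. f x \<bullet> g x)"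
    using assms sq_int_inner[OF assms] by (auto simp: sq_int_def)
  have quad: "0 \<le> s\<^sup>2 * ?F - 2 * s * t * ?H + t\<^sup>2 * ?G" for s t :: real
  proof -
    have "0 \<le> (LINT x|M. (s *\<^sub>R f x - t *\<^sub>R g x) \<bullet> (s *\<^sub>R f x - t *\<^sub>R g x))"
      by (rule Bochner_Integration.integral_nonneg) simp
    also have "\<dots> = (LINT x|M. s\<^sup>2 * (f x \<bullet> f x) - 2 * s * t * (f x \<bullet> g x) + t\<^sup>2 * (g x \<bullet> g x))"
      by (rule Bochner_Integration.integral_cong)
         (auto simp: inner_diff_left inner_diff_right inner_commute power2_eq_square algebra_simps)
    also have "\<dots> = s\<^sup>2 * ?F - 2 * s * t * ?H + t\<^sup>2 * ?G"
      using int by simp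
    finally show ?thesis .
  qed
  have nonneg: "0 \<le> ?F" "0 \<le> ?G"
    by (auto intro: Bochner_Integration.integral_nonneg)
  show ?thesis
  proof (cases "?G = 0")
    case True
    show ?thesis
    proof (rule ccontr)
      assume "\<not> ?thesis"
      then have "?H \<noteq> 0"
        using True by auto
      have "0 \<le> ?F - 2 * ((?F + 1) / (2 * ?H)) * ?H"
        using quad[of 1 "(?F + 1) / (2 * ?H)"] True by simp
      then show False
        using \<open>?H \<noteq> 0\<close> by (simp add: field_simps)
    qed
  next
    case False
    with nonneg have "0 < ?G" by linarith
    have "0 \<le> ?G * (?F * ?G - ?H\<^sup>2)"
      using quad[of ?G ?H] by (simp add: power2_eq_square algebra_simps)
    then show ?thesis
      using \<open>0 < ?G\<close> by (simp add: zero_le_mult_iff)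
  qed
qed

lemma L2_dist_triangle:
  assumes "sq_int M f" "sq_int M g" "sq_int M h"
  shows "(LINT x|M. (f x - h x) \<bullet> (f x - h x))
    \<le> 2 * (LINT x|M. (f x - g x) \<bullet> (f x - g x)) + 2 * (LINT x|M. (g x - h x) \<bullet> (g x - h x))"
proof -
  have int: "integrable M (\<lambda>x. (f x - g x) \<bullet> (f x - g x))" "integrable M (\<lambda>x. (g x - h x) \<bullet> (g x - h x))"
    "integrable M (\<lambda>x. (f x - h x) \<bullet> (f x - h x))"
    using assms by (auto intro!: sq_int_square)
  have "(u - w) \<bullet> (u - w) \<le> 2 * ((u - v) \<bullet> (u - v)) + 2 * ((v - w) \<bullet> (v - w))" for u v w :: 'b
  proof -
    have "0 \<le> ((u - v) - (v - w)) \<bullet> ((u - v) - (v - w))"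
      by (rule inner_ge_zero)
    then show ?thesis
      by (simp add: inner_diff_left inner_diff_right inner_commute algebra_simps)
  qed
  then have "(LINT x|M. (f x - h x) \<bullet> (f x - h x))
    \<le> (LINT x|M. 2 * ((f x - g x) \<bullet> (f x - g x)) + 2 * ((g x - h x) \<bullet> (g x - h x)))"
    using int by (intro integral_mono) auto
  then show ?thesis
    using int by simp
qed

definition L2_tendsto ::
  "'a measure \<Rightarrow> (nat \<Rightarrow> 'a \<Rightarrow> 'e::euclidean_space) \<Rightarrow> ('a \<Rightarrow> 'e) \<Rightarrow> bool" where
  "L2_tendsto M F f \<longleftrightarrow> (\<forall>n. sq_int M (F n)) \<and> sq_int M f \<and>
     (\<lambda>n. LINT x|M. (F n x - f x) \<bullet> (F n x - f x)) \<longlonglongrightarrow> 0"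

lemma L2_tendsto_const: "sq_int M f \<Longrightarrow> L2_tendsto M (\<lambda>n. f) f"
  by (simp add: L2_tendsto_def)

lemma L2_tendsto_subseq:
  assumes "L2_tendsto M F f" "strict_mono r"
  shows "L2_tendsto M (\<lambda>n. F (r n)) f"
  using assms LIMSEQ_subseq_LIMSEQ[of "\<lambda>n. LINT x|M. (F n x - f x) \<bullet> (F n x - f x)" 0 r]
  by (auto simp: L2_tendsto_def o_def)

text \<open>
  Strong convergence of both factors, so the difference of the products splits into three terms, each
  with a factor that tends to zero.
\<close>

lemma L2_tendsto_inner:
  assumes F: "L2_tendsto M F f" and G: "L2_tendsto M G g"
  shows "(\<lambda>n. LINT x|M. F n x \<bullet> G n x) \<longlonglongrightarrow> (LINT x|M. f x \<bullet> g x)"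
proof -
  have sq: "sq_int M (F n)" "sq_int M f" "sq_int M (G n)" "sq_int M g" for n
    using assms by (auto simp: L2_tendsto_def)
  define df dg where "df n x = F n x - f x" and "dg n x = G n x - g x" for n x
  have sqd: "sq_int M (df n)" "sq_int M (dg n)" for n
    using sq by (auto simp: df_def[abs_def] dg_def[abs_def])
  have lim: "(\<lambda>n. LINT x|M. df n x \<bullet> df n x) \<longlonglongrightarrow> 0" "(\<lambda>n. LINT x|M. dg n x \<bullet> dg n x) \<longlonglongrightarrow> 0"
    using assms by (auto simp: L2_tendsto_def df_def dg_def)
  have null: "(\<lambda>n. LINT x|M. P n x \<bullet> Q n x) \<longlonglongrightarrow> 0"
    if "\<And>n. sq_int M (P n)" "\<And>n. sq_int M (Q n)"
      "(\<lambda>n. (LINT x|M. P n x \<bullet> P n x) * (LINT x|M. Q n x \<bullet> Q n x)) \<longlonglongrightarrow> 0" for P Q :: "nat \<Rightarrow> 'a \<Rightarrow> 'b"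
  proof -
    have "(\<lambda>n. (LINT x|M. P n x \<bullet> Q n x)\<^sup>2) \<longlonglongrightarrow> 0"
      by (rule tendsto_sandwich[OF _ _ tendsto_const that(3)])
         (use inner_integral_square_le[OF that(1,2)] in auto)
    then show ?thesis
      using tendsto_power_zero tendsto_real_sqrt[of "\<lambda>n. (LINT x|M. P n x \<bullet> Q n x)\<^sup>2" 0]
      by (auto intro: tendsto_rabs_zero_cancel)
  qed
  have "(\<lambda>n. (LINT x|M. df n x \<bullet> dg n x) + (LINT x|M. df n x \<bullet> g x) + (LINT x|M. f x \<bullet> dg n x)
           + (LINT x|M. f x \<bullet> g x)) \<longlonglongrightarrow> 0 + 0 + 0 + (LINT x|M. f x \<bullet> g x)"
    by (intro tendsto_add null tendsto_const sq sqd)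
       (use tendsto_mult[OF lim] tendsto_mult[OF lim(1) tendsto_const]
            tendsto_mult[OF tendsto_const lim(2)] in auto)
  moreover have "(LINT x|M. df n x \<bullet> dg n x) + (LINT x|M. df n x \<bullet> g x) + (LINT x|M. f x \<bullet> dg n x)
           + (LINT x|M. f x \<bullet> g x) = (LINT x|M. F n x \<bullet> G n x)" for n
  proof -
    have "F n x \<bullet> G n x = df n x \<bullet> dg n x + df n x \<bullet> g x + f x \<bullet> dg n x + f x \<bullet> g x" for x
      by (simp add: df_def dg_def inner_diff_left inner_diff_right)
    then show ?thesis
      using sq sqd by (simp add: sq_int_inner)
  qed
  ultimately show ?thesis
    by simp
qed

lemma L2_tendsto_dominated:
  assumes "\<And>n. F n \<in> borel_measurable M" "sq_int M g"
    "\<And>n. AE x in M. norm (F n x) \<le> norm (g x)"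
    "f \<in> borel_measurable M" "AE x in M. (\<lambda>n. F n x) \<longlonglongrightarrow> f x"
  shows "L2_tendsto M F f"
proof -
  have all: "AE x in M. \<forall>n. norm (F n x) \<le> norm (g x)"
    using assms(3) by (simp add: AE_all_countable)
  have f_le: "AE x in M. norm (f x) \<le> norm (g x)"
    using all assms(5)
  proof eventually_elim
    case (elim x)
    then show ?case
      by (intro LIMSEQ_le_const2[OF tendsto_norm]) auto
  qed
  have sq: "sq_int M (F n)" "sq_int M f" for n
    using assms(3)[of n] f_le
    by (auto intro!: sq_int_dominated[OF _ assms(2), where C = 1] assms(1,4))
  have "(\<lambda>n. LINT x|M. (F n x - f x) \<bullet> (F n x - f x)) \<longlonglongrightarrow> (LINT x|M. 0)"
  proof (rule integral_dominated_convergence)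
    show "integrable M (\<lambda>x. 4 * (g x \<bullet> g x))"
      using assms(2) by (simp add: sq_int_def)
    show "AE x in M. norm ((F n x - f x) \<bullet> (F n x - f x)) \<le> 4 * (g x \<bullet> g x)" for n
      using assms(3)[of n] f_le
    proof eventually_elim
      case (elim x)
      then have "norm (F n x - f x) \<le> 2 * norm (g x)"
        using norm_triangle_ineq4[of "F n x" "f x"] by linarith
      then have "(norm (F n x - f x))\<^sup>2 \<le> (2 * norm (g x))\<^sup>2"
        by (intro power_mono) auto
      then show ?case
        by (simp add: dot_square_norm power_mult_distrib)
    qed
    show "AE x in M. (\<lambda>n. (F n x - f x) \<bullet> (F n x - f x)) \<longlonglongrightarrow> 0"
      using assms(5)
    proof eventually_elim
      case (elim x)
      then have "(\<lambda>n. F n x - f x) \<longlonglongrightarrow> 0"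
        by (simp add: LIM_zero)
      then show ?case
        using tendsto_inner[of "\<lambda>n. F n x - f x" 0 _ "\<lambda>n. F n x - f x" 0] by simp
    qed
  qed (use sq assms in \<open>auto simp: sq_int_def\<close>)
  then show ?thesis
    using sq by (simp add: L2_tendsto_def)
qed

lemma L2_tendsto_AE_subseq:
  assumes "L2_tendsto M F f"
  obtains r where "strict_mono r" "AE x in M. (\<lambda>n. F (r n) x) \<longlonglongrightarrow> f x"
proof -
  have int: "integrable M (\<lambda>x. (F n x - f x) \<bullet> (F n x - f x))" for n
    using assms by (auto simp: L2_tendsto_def intro!: sq_int_square)
  have "(\<lambda>n. LINT x|M. norm ((F n x - f x) \<bullet> (F n x - f x))) \<longlonglongrightarrow> 0"
    using assms by (simp add: L2_tendsto_def)
  from tendsto_L1_AE_subseq[OF int this]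
  obtain r where r: "strict_mono r"
    "AE x in M. (\<lambda>n. (F (r n) x - f x) \<bullet> (F (r n) x - f x)) \<longlonglongrightarrow> 0"
    by blast
  from r(2) have "AE x in M. (\<lambda>n. F (r n) x) \<longlonglongrightarrow> f x"
  proof eventually_elim
    case (elim x)
    then have "(\<lambda>n. norm (F (r n) x - f x)) \<longlonglongrightarrow> 0"
      using tendsto_real_sqrt[of "\<lambda>n. (F (r n) x - f x) \<bullet> (F (r n) x - f x)" 0]
      by (simp add: norm_eq_sqrt_inner)
    then show ?case
      by (rule LIM_zero_cancel[OF tendsto_norm_zero_cancel])
  qed
  with r(1) show thesis
    using that by blast
qed

lemma L2_tendsto_vecI:
  fixes f :: "'a \<Rightarrow> real^'n"
  assumes "\<And>i. L2_tendsto M (\<lambda>n x. F n x $ i) (\<lambda>x. f x $ i)"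
  shows "L2_tendsto M F f"
proof -
  have sq: "sq_int M (F n)" "sq_int M f" for n
    using assms by (auto simp: L2_tendsto_def intro: sq_int_vecI)
  have "sq_int M (\<lambda>x. F n x $ i - f x $ i)" for n i
    using assms[of i] by (auto simp: L2_tendsto_def)
  then have "integrable M (\<lambda>x. (F n x $ i - f x $ i) \<bullet> (F n x $ i - f x $ i))" for n i
    by (rule sq_int_square)
  then have "(LINT x|M. (F n x - f x) \<bullet> (F n x - f x))
      = (\<Sum>i\<in>UNIV. LINT x|M. (F n x $ i - f x $ i) \<bullet> (F n x $ i - f x $ i))" for n
    by (simp add: inner_vec_def)
  moreover have "(\<lambda>n. \<Sum>i\<in>UNIV. LINT x|M. (F n x $ i - f x $ i) \<bullet> (F n x $ i - f x $ i))
      \<longlonglongrightarrow> (\<Sum>i\<in>(UNIV::'n set). 0)"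
    using assms by (intro tendsto_sum) (auto simp: L2_tendsto_def)
  ultimately show ?thesis
    using sq by (simp add: L2_tendsto_def)
qed

text \<open>
  The Lebesgue measure is complete, so almost everywhere equal functions are both measurable or both
  not, and in the second case both integrals are 0. This makes it possible to rewrite under the
  integral with the almost everywhere identities of the scheme without knowing that quantities such
  as \<open>unit_grad\<close> are measurable.
\<close>

lemma lebesgue_on_integral_cong_AE:
  fixes f g :: "'a::euclidean_space \<Rightarrow> 'b::euclidean_space"
  assumes S: "S \<in> sets lebesgue" and ae: "AE x in lebesgue_on S. f x = g x"
  shows "integral\<^sup>L (lebesgue_on S) f = integral\<^sup>L (lebesgue_on S) g"
proof -
  have ae': "AE x in lebesgue. indicator S x *\<^sub>R f x = indicator S x *\<^sub>R g x"
    using ae S by (simp add: AE_restrict_space_iff) (auto simp: indicator_def elim: eventually_mono)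
  have meas: "k \<in> borel_measurable lebesgue" if "h \<in> borel_measurable lebesgue"
    "AE x in lebesgue. h x = k x" for h k :: "'a \<Rightarrow> 'b"
    using borel_measurable_AE that by blast
  have "integral\<^sup>L lebesgue (\<lambda>x. indicator S x *\<^sub>R f x) = integral\<^sup>L lebesgue (\<lambda>x. indicator S x *\<^sub>R g x)"
  proof (cases "(\<lambda>x. indicator S x *\<^sub>R f x) \<in> borel_measurable lebesgue")
    case True
    with meas[OF True ae'] ae' show ?thesis
      by (intro integral_cong_AE) auto
  next
    case False
    have "AE x in lebesgue. indicator S x *\<^sub>R g x = indicator S x *\<^sub>R f x"
      using ae' by (auto elim: eventually_mono)
    with meas[of "\<lambda>x. indicator S x *\<^sub>R g x" "\<lambda>x. indicator S x *\<^sub>R f x"] False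
    have "(\<lambda>x. indicator S x *\<^sub>R g x) \<notin> borel_measurable lebesgue"
      by auto
    with False have "\<not> integrable lebesgue (\<lambda>x. indicator S x *\<^sub>R f x)"
      "\<not> integrable lebesgue (\<lambda>x. indicator S x *\<^sub>R g x)"
      using borel_measurable_integrable by blast+
    then show ?thesis
      by (simp add: not_integrable_integral_eq)
  qed
  then show ?thesis
    using S by (simp add: integral_restrict_space)
qed

section \<open>Linear spans and trigonometric polynomials\<close>

text \<open>
  The linear span, as an inductive set so that the spanning set may be infinite while each element
  involves only finitely many of its members.
\<close>

inductive_set lspan :: "('a \<Rightarrow> real) set \<Rightarrow> ('a \<Rightarrow> real) set" for S where
  zero: "(\<lambda>x. 0) \<in> lspan S"
| step: "s \<in> S \<Longrightarrow> f \<in> lspan S \<Longrightarrow> (\<lambda>x. c * s x + f x) \<in> lspan S"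

lemma lspan_add: "f \<in> lspan S \<Longrightarrow> g \<in> lspan S \<Longrightarrow> (\<lambda>x. f x + g x) \<in> lspan S"
  by (induction rule: lspan.induct) (auto simp: add.assoc intro: lspan.step)

lemma lspan_scale: "f \<in> lspan S \<Longrightarrow> (\<lambda>x. c * f x) \<in> lspan S"
  by (induction rule: lspan.induct)
     (auto simp: distrib_left mult.assoc[symmetric] intro: lspan.intros)

lemma lspan_base: "s \<in> S \<Longrightarrow> s \<in> lspan S"
  using lspan.step[OF _ lspan.zero, of s S 1] by simp

lemma lspan_diff: "f \<in> lspan S \<Longrightarrow> g \<in> lspan S \<Longrightarrow> (\<lambda>x. f x - g x) \<in> lspan S"
  using lspan_add[OF _ lspan_scale[of g S "-1"], of f] by simp

lemma lspan_mono:
  assumes "S \<subseteq> T" "f \<in> lspan S"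
  shows "f \<in> lspan T"
  using assms(2) by induction (use assms(1) in \<open>auto intro: lspan.intros\<close>)

text \<open>
  The wave vectors for which plane waves are periodic with respect to the box.
\<close>

definition freq :: "real^'d \<Rightarrow> real^'d \<Rightarrow> int^'d \<Rightarrow> real^'d" where
  "freq a b k = (\<chi> i. 2 * pi * of_int (k $ i) / (b $ i - a $ i))"

definition cos_mode :: "real^'d \<Rightarrow> real^'d \<Rightarrow> int^'d \<Rightarrow> real^'d \<Rightarrow> real" where
  "cos_mode a b k x = cos (freq a b k \<bullet> x)"

definition sin_mode :: "real^'d \<Rightarrow> real^'d \<Rightarrow> int^'d \<Rightarrow> real^'d \<Rightarrow> real" where
  "sin_mode a b k x = sin (freq a b k \<bullet> x)"

definition modes :: "real^'d \<Rightarrow> real^'d \<Rightarrow> (int^'d) set \<Rightarrow> (real^'d \<Rightarrow> real) set" where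
  "modes a b K = cos_mode a b ` K \<union> sin_mode a b ` K"

abbreviation trig_poly :: "real^'d \<Rightarrow> real^'d \<Rightarrow> (real^'d \<Rightarrow> real) set" where
  "trig_poly a b \<equiv> lspan (modes a b UNIV)"

lemma modes_cases:
  assumes "s \<in> modes a b K"
  obtains k where "k \<in> K" "s = cos_mode a b k" | k where "k \<in> K" "s = sin_mode a b k"
  using assms by (auto simp: modes_def)

lemma modes_mono: "K \<subseteq> L \<Longrightarrow> modes a b K \<subseteq> modes a b L"
  by (auto simp: modes_def)

lemma finite_modes: "finite K \<Longrightarrow> finite (modes a b K)"
  by (simp add: modes_def)

text \<open>
  Every trigonometric polynomial lives in the span of finitely many modes. Such a span is the finite
  dimensional space onto which functions are projected later.
\<close>

lemma lspan_finite:
  assumes "f \<in> lspan (modes a b UNIV)"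
  shows "\<exists>K. finite K \<and> f \<in> lspan (modes a b K)"
  using assms
proof induction
  case zero
  then show ?case
    by (auto intro!: exI[of _ "{}"] lspan.zero)
next
  case (step s f c)
  then obtain K where K: "finite K" "f \<in> lspan (modes a b K)"
    by blast
  from step.hyps(1) obtain k where k: "s \<in> modes a b {k}"
    by (auto simp: modes_def)
  have "(\<lambda>x. c * s x + f x) \<in> lspan (modes a b (insert k K))"
    using k K(2) lspan_mono[OF modes_mono, of K "insert k K"] modes_mono[of "{k}" "insert k K" a b]
    by (intro lspan.step) auto
  then show ?case
    using K(1) by blast
qed

section \<open>Smoothness of trigonometric polynomials\<close>

lemma pderivI: "(f has_derivative f') (at x) \<Longrightarrow> pderiv i f x = f' (axis i 1)"
  using frechet_derivative_at[of f f' x] by (simp add: pderiv_def)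

lemma has_derivative_frechet: "f differentiable at x \<Longrightarrow> (f has_derivative frechet_derivative f (at x)) (at x)"
  by (simp add: frechet_derivative_works)

lemma pderiv_add:
  assumes "f differentiable at x" "g differentiable at x"
  shows "pderiv i (\<lambda>x. f x + g x) x = pderiv i f x + pderiv i g x"
  using pderivI[OF has_derivative_add[OF assms[THEN has_derivative_frechet]]]
  by (simp add: pderiv_def)

lemma pderiv_mult:
  assumes "f differentiable at x" "g differentiable at x"
  shows "pderiv i (\<lambda>x. f x * g x) x = pderiv i f x * g x + f x * pderiv i g x"
  using pderivI[OF has_derivative_mult[OF assms[THEN has_derivative_frechet]]]
  by (simp add: pderiv_def add.commute)

lemma pderiv_cmult:
  assumes "f differentiable at x"
  shows "pderiv i (\<lambda>x. c * f x) x = c * pderiv i f x"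
  using pderivI[OF has_derivative_mult_right[OF assms[THEN has_derivative_frechet]]]
  by (simp add: pderiv_def)

lemma pderiv_const [simp]: "pderiv i (\<lambda>x. c) = (\<lambda>x. 0)"
  by (rule ext) (simp add: pderivI[OF has_derivative_const])

lemma pderiv_inverse:
  assumes "f differentiable at x" "f x \<noteq> 0"
  shows "pderiv i (\<lambda>x. inverse (f x)) x = - pderiv i f x * (inverse (f x) * inverse (f x))"
  using pderivI[OF Deriv.has_derivative_inverse[OF assms(2) assms(1)[THEN has_derivative_frechet]]]
  by (simp add: pderiv_def)

lemma Ck_SucD: "Ck (Suc k) f \<Longrightarrow> Ck k f"
proof (induction k arbitrary: f)
  case 0
  then show ?case
    by (auto simp: continuous_on_eq_continuous_at differentiable_imp_continuous_within)
next
  case (Suc k)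
  have "Ck (Suc k) (pderiv i f)" for i
    using Suc.prems by simp
  then have "Ck k (pderiv i f)" for i
    using Suc.IH by blast
  then show ?case
    using Suc.prems by simp
qed

lemma Ck_differentiable: "Ck (Suc k) f \<Longrightarrow> f differentiable at x"
  by simp

lemma Ck_const [simp]: "Ck k (\<lambda>x. c)"
  by (induction k arbitrary: c) (auto simp: Ck_differentiable)

lemma Ck_add: "Ck k f \<Longrightarrow> Ck k g \<Longrightarrow> Ck k (\<lambda>x. f x + g x)"
proof (induction k arbitrary: f g)
  case (Suc k)
  then have "pderiv i (\<lambda>x. f x + g x) = (\<lambda>x. pderiv i f x + pderiv i g x)" for i
    by (intro ext pderiv_add) auto
  then show ?case
    using Suc by auto
qed (auto intro: continuous_intros)

lemma Ck_mult: "Ck k f \<Longrightarrow> Ck k g \<Longrightarrow> Ck k (\<lambda>x. f x * g x)"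
proof (induction k arbitrary: f g)
  case (Suc k)
  then have "pderiv i (\<lambda>x. f x * g x) = (\<lambda>x. pderiv i f x * g x + f x * pderiv i g x)" for i
    by (intro ext pderiv_mult) auto
  moreover have "Ck k f" "Ck k g"
    using Suc.prems by (auto intro: Ck_SucD simp del: Ck.simps)
  ultimately show ?case
    using Suc by (auto intro!: Ck_add)
qed (auto intro: continuous_intros)

text \<open>
  The bounded test functions of the convection term are reciprocals of trigonometric polynomials; this
  makes them smooth.
\<close>

lemma Ck_inverse:
  assumes "\<And>x. f x \<noteq> 0"
  shows "Ck k f \<Longrightarrow> Ck k (\<lambda>x. inverse (f x))"
proof (induction k)
  case 0
  then show ?case
    using assms by (auto intro: continuous_intros)
next
  case (Suc k)
  then have eq: "pderiv i (\<lambda>x. inverse (f x)) =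
      (\<lambda>x. (-1) * (pderiv i f x * (inverse (f x) * inverse (f x))))" for i
    using assms by (intro ext, subst pderiv_inverse) auto
  have "Ck k (\<lambda>x. inverse (f x))"
    using Suc Ck_SucD by blast
  moreover have "(\<lambda>x. inverse (f x)) differentiable at x" for x
    using Suc.prems assms by (auto intro!: differentiable_inverse)
  ultimately show ?case
    using Suc.prems unfolding Ck.simps eq by (intro conjI allI Ck_mult Ck_const) auto
qed

lemma modes_has_derivative:
  "(cos_mode a b k has_derivative (\<lambda>h. - sin_mode a b k x * (freq a b k \<bullet> h))) (at x)"
  "(sin_mode a b k has_derivative (\<lambda>h. cos_mode a b k x * (freq a b k \<bullet> h))) (at x)"
  unfolding cos_mode_def[abs_def] sin_mode_def[abs_def]
  by (auto intro!: derivative_eq_intros simp: mult.commute)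

lemma pderiv_modes:
  "pderiv i (cos_mode a b k) = (\<lambda>x. - (freq a b k $ i) * sin_mode a b k x)"
  "pderiv i (sin_mode a b k) = (\<lambda>x. freq a b k $ i * cos_mode a b k x)"
  by (auto simp: pderivI[OF modes_has_derivative(1)] pderivI[OF modes_has_derivative(2)]
      inner_axis fun_eq_iff)

lemma Ck_modes: "Ck n (cos_mode a b k)" "Ck n (sin_mode a b k)"
proof (induction n)
  case 0
  {
    case 1
    show ?case
      using modes_has_derivative(1)[of a b k]
      by (auto simp: continuous_on_eq_continuous_at dest!: has_derivative_continuous)
  next
    case 2
    show ?case
      using modes_has_derivative(2)[of a b k]
      by (auto simp: continuous_on_eq_continuous_at dest!: has_derivative_continuous)
  }
next
  case (Suc n)
  {
    case 1
    show ?case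
      using Suc modes_has_derivative(1)[of a b k] Ck_mult[OF Ck_const Suc(2)]
      unfolding Ck.simps pderiv_modes differentiable_def by blast
  next
    case 2
    show ?case
      using Suc modes_has_derivative(2)[of a b k] Ck_mult[OF Ck_const Suc(1)]
      unfolding Ck.simps pderiv_modes differentiable_def by blast
  }
qed

lemma Ck_trig_poly: "f \<in> trig_poly a b \<Longrightarrow> Ck n f"
  by (induction rule: lspan.induct) (auto intro!: Ck_add Ck_mult[OF Ck_const] simp: Ck_modes modes_def)

lemma differentiable_trig_poly: "f \<in> trig_poly a b \<Longrightarrow> f differentiable at x"
  using Ck_trig_poly[of f a b "Suc 0"] by simp

text \<open>
  Differentiation only exchanges the sine and the cosine of one wave vector, so it maps the span of
  the modes of any set of wave vectors into itself. The density theorem depends on this.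
\<close>

lemma pderiv_trig_poly:
  assumes "f \<in> lspan (modes a b K)"
  shows "pderiv i f \<in> lspan (modes a b K)"
  using assms
proof induction
  case zero
  then show ?case
    by (simp add: lspan.zero)
next
  case (step s f c)
  have "s \<in> lspan (modes a b UNIV)" "f \<in> lspan (modes a b UNIV)"
    using step.hyps modes_mono[of K UNIV a b] lspan_mono[of "modes a b K" "modes a b UNIV"]
    by (auto intro: lspan_base)
  then have "s differentiable at x" "f differentiable at x" for x
    by (auto intro: differentiable_trig_poly)
  then have "pderiv i (\<lambda>x. c * s x + f x) = (\<lambda>x. c * pderiv i s x + pderiv i f x)"
    by (intro ext) (simp add: pderiv_add pderiv_cmult)
  moreover have "pderiv i s \<in> lspan (modes a b K)"
    using step.hyps(1)
  proof (cases rule: modes_cases)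
    case (1 k)
    then show ?thesis
      unfolding 1 pderiv_modes by (intro lspan_scale lspan_base) (auto simp: modes_def)
  next
    case (2 k)
    then show ?thesis
      unfolding 2 pderiv_modes by (intro lspan_scale lspan_base) (auto simp: modes_def)
  qed
  ultimately show ?case
    using step.IH by (simp add: lspan_add lspan_scale)
qed

lemma freq_add: "freq a b k + freq a b l = freq a b (k + l)"
  by (simp add: freq_def vec_eq_iff add_divide_distrib algebra_simps)

lemma freq_diff: "freq a b k - freq a b l = freq a b (k - l)"
  by (simp add: freq_def vec_eq_iff diff_divide_distrib algebra_simps)

lemma modes_mult:
  "cos_mode a b k x * cos_mode a b l x = (cos_mode a b (k - l) x + cos_mode a b (k + l) x) / 2"
  "sin_mode a b k x * sin_mode a b l x = (cos_mode a b (k - l) x - cos_mode a b (k + l) x) / 2"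
  "sin_mode a b k x * cos_mode a b l x = (sin_mode a b (k + l) x + sin_mode a b (k - l) x) / 2"
  by (simp_all add: cos_mode_def sin_mode_def freq_add[symmetric] freq_diff[symmetric]
      inner_add_left inner_diff_left cos_times_cos sin_times_sin sin_times_cos)

lemma cos_mode_in_trig_poly: "cos_mode a b k \<in> trig_poly a b"
  and sin_mode_in_trig_poly: "sin_mode a b k \<in> trig_poly a b"
  by (auto intro!: lspan_base simp: modes_def)

lemma trig_poly_mult:
  assumes "f \<in> trig_poly a b" "g \<in> trig_poly a b"
  shows "(\<lambda>x. f x * g x) \<in> trig_poly a b"
proof -
  have modes: "(\<lambda>x. s x * t x) \<in> trig_poly a b" if "s \<in> modes a b UNIV" "t \<in> modes a b UNIV" for s t
  proof -
    have *: "(\<lambda>x. (f x + g x) / 2) \<in> trig_poly a b" "(\<lambda>x. (f x - g x) / 2) \<in> trig_poly a b"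
      if "f \<in> trig_poly a b" "g \<in> trig_poly a b" for f g
      using lspan_scale[OF lspan_add[OF that], of "1/2"] lspan_scale[OF lspan_diff[OF that], of "1/2"]
      by simp_all
    show ?thesis
      using that(1)
    proof (cases rule: modes_cases)
      case (1 k)
      show ?thesis
        using that(2) by (cases rule: modes_cases)
          (auto simp: 1 modes_mult mult.commute[of "cos_mode _ _ _ _" "sin_mode _ _ _ _"]
                intro!: * cos_mode_in_trig_poly sin_mode_in_trig_poly)
    next
      case (2 k)
      show ?thesis
        using that(2) by (cases rule: modes_cases)
          (auto simp: 2 modes_mult intro!: * cos_mode_in_trig_poly sin_mode_in_trig_poly)
    qed
  qed
  have mode_left: "(\<lambda>x. s x * g x) \<in> trig_poly a b" if "s \<in> modes a b UNIV" for s
    using assms(2)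
  proof induction
    case (step t g c)
    have "(\<lambda>x. c * (s x * t x) + s x * g x) \<in> trig_poly a b"
      using step that modes by (intro lspan_add lspan_scale) auto
    then show ?case
      by (simp add: algebra_simps)
  qed (simp add: lspan.zero)
  show ?thesis
    using assms(1)
  proof induction
    case (step s f c)
    have "(\<lambda>x. c * (s x * g x) + f x * g x) \<in> trig_poly a b"
      using step mode_left by (intro lspan_add lspan_scale) auto
    then show ?case
      by (simp add: algebra_simps)
  qed (simp add: lspan.zero)
qed

lemma trig_poly_const: "(\<lambda>x. c) \<in> trig_poly a b"
proof -
  have "cos_mode a b 0 = (\<lambda>x. 1)"
    by (simp add: cos_mode_def fun_eq_iff freq_def inner_vec_def)
  then show ?thesis
    using lspan_scale[OF cos_mode_in_trig_poly[of a b 0], of c] by simp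
qed

lemma periodic_trig_poly:
  assumes "\<And>i. a $ i < b $ i" "f \<in> trig_poly a b"
  shows "periodic a b f"
  using assms(2)
proof induction
  case (step s f c)
  have shift: "freq a b k \<bullet> (x + (b $ i - a $ i) *\<^sub>R axis i 1) = freq a b k \<bullet> x + 2 * pi * of_int (k $ i)"
    for k i x
    using assms(1)[of i] by (simp add: inner_add_right inner_axis freq_def)
  have "periodic a b s"
    using step.hyps(1)
    by (cases rule: modes_cases)
       (simp_all add: periodic_def cos_mode_def[abs_def] sin_mode_def[abs_def] shift cos_add sin_add)
  then show ?case
    using step.IH by (simp add: periodic_def)
qed (simp add: periodic_def)

lemma trig_poly_in_Cinf_per:
  assumes "\<And>i. a $ i < b $ i" "f \<in> trig_poly a b"
  shows "f \<in> Cinf_per a b"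
  using periodic_trig_poly[OF assms] Ck_trig_poly[OF assms(2)] by (simp add: Cinf_per_def)

section \<open>Orthogonal projection onto a finite span\<close>

lemma sq_int_lspan:
  assumes "\<And>s. s \<in> S \<Longrightarrow> sq_int M s" "f \<in> lspan S"
  shows "sq_int M f"
  using assms(2)
proof induction
  case (step s f c)
  then show ?case
    by (intro sq_int_add sq_int_mult assms(1)[OF step.hyps(1)])
qed simp

lemma orthogonal_lspan:
  assumes S: "\<And>s. s \<in> S \<Longrightarrow> sq_int M s" and f: "sq_int M f"
    and orth: "\<And>s. s \<in> S \<Longrightarrow> (LINT x|M. f x * s x) = 0" and q: "q \<in> lspan S"
  shows "(LINT x|M. f x * q x) = 0"
  using q
proof induction
  case (step s q c)
  have "integrable M (\<lambda>x. f x * s x)" "integrable M (\<lambda>x. f x * q x)"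
    using sq_int_inner[OF f S[OF step.hyps(1)]] sq_int_inner[OF f sq_int_lspan[OF S step.hyps(2)]]
    by auto
  moreover have "f x * (c * s x + q x) = c * (f x * s x) + f x * q x" for x
    by (simp add: algebra_simps)
  ultimately show ?case
    using step.IH orth[OF step.hyps(1)] by simp
qed simp

text \<open>
  Gram-Schmidt, one spanning function at a time. A new function \<open>e\<close> contributes the component \<open>r\<close> of
  \<open>e\<close> that is orthogonal to the previous span. If \<open>r\<close> vanishes almost everywhere, the coefficient
  \<open>t\<close> is a division by 0, that is 0, and the projection does not change.
\<close>

lemma L2_projection_exists:
  fixes f :: "'a \<Rightarrow> real"
  assumes "finite S" "\<And>s. s \<in> S \<Longrightarrow> sq_int M s" "sq_int M f"
  shows "\<exists>p\<in>lspan S. \<forall>s\<in>S. (LINT x|M. (f x - p x) * s x) = 0"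
  using assms
proof (induction arbitrary: f rule: finite_induct)
  case empty
  then show ?case
    by (auto intro: lspan.zero)
next
  case (insert e S)
  have S: "\<And>s. s \<in> S \<Longrightarrow> sq_int M s" and e: "sq_int M e"
    using insert.prems by auto
  have mono: "q \<in> lspan (insert e S)" if "q \<in> lspan S" for q
    using that lspan_mono[of S "insert e S"] by blast
  obtain pe where pe: "pe \<in> lspan S" "\<And>s. s \<in> S \<Longrightarrow> (LINT x|M. (e x - pe x) * s x) = 0"
    using insert.IH[OF S e] by blast
  obtain pf where pf: "pf \<in> lspan S" "\<And>s. s \<in> S \<Longrightarrow> (LINT x|M. (f x - pf x) * s x) = 0"
    using insert.IH[OF S insert.prems(2)] by blast
  define r where "r x = e x - pe x" for x
  define t where "t = (LINT x|M. (f x - pf x) * r x) / (LINT x|M. r x * r x)"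
  have sq: "sq_int M pe" "sq_int M pf"
    using sq_int_lspan[OF S] pe(1) pf(1) by blast+
  then have sqr: "sq_int M r" "sq_int M (\<lambda>x. f x - pf x)"
    using e insert.prems(2) by (auto simp: r_def[abs_def])
  define p where "p x = pf x + t * r x" for x
  have sqp: "sq_int M (\<lambda>x. f x - p x)"
    unfolding p_def using sqr sq insert.prems(2) by (intro sq_int_diff sq_int_add sq_int_mult)
  have fp: "(f x - p x) * q x = (f x - pf x) * q x - t * (r x * q x)" for q x
    by (simp add: p_def algebra_simps)
  have p_int: "(LINT x|M. (f x - p x) * q x) = (LINT x|M. (f x - pf x) * q x) - t * (LINT x|M. r x * q x)"
    if "sq_int M q" for q
    using sq_int_inner[OF sqr(1) that] sq_int_inner[OF sqr(2) that] unfolding fp by simp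
  have p_r: "(LINT x|M. (f x - p x) * r x) = 0"
  proof (cases "(LINT x|M. r x * r x) = 0")
    case True
    then have "(LINT x|M. (f x - pf x) * r x)\<^sup>2 \<le> 0"
      using inner_integral_square_le[OF sqr(2,1)] by simp
    then show ?thesis
      using p_int[OF sqr(1)] True by simp
  next
    case False
    then show ?thesis
      using p_int[OF sqr(1)] by (simp add: t_def)
  qed
  have p_S: "(LINT x|M. (f x - p x) * s x) = 0" if "s \<in> S" for s
    using p_int[OF S[OF that]] pe(2)[OF that] pf(2)[OF that] by (simp add: r_def)
  have p_e: "(LINT x|M. (f x - p x) * e x) = 0"
  proof -
    have "(f x - p x) * e x = (f x - p x) * r x + (f x - p x) * pe x" for x
      by (simp add: r_def algebra_simps)
    then have "(LINT x|M. (f x - p x) * e x) = (LINT x|M. (f x - p x) * r x) + (LINT x|M. (f x - p x) * pe x)"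
      using sq_int_inner[OF sqp sqr(1)] sq_int_inner[OF sqp sq(1)] by simp
    also have "(LINT x|M. (f x - p x) * pe x) = 0"
      using orthogonal_lspan[OF S sqp p_S pe(1)] by blast
    finally show ?thesis
      using p_r by simp
  qed
  have "r \<in> lspan (insert e S)"
    using lspan_diff[OF lspan_base[of e "insert e S"] mono[OF pe(1)]] by (simp add: r_def[abs_def])
  then have "p \<in> lspan (insert e S)"
    unfolding p_def[abs_def] by (rule lspan_add[OF mono[OF pf(1)] lspan_scale])
  then show ?case
    using p_S p_e by auto
qed

text \<open>
  Pythagoras: \<open>f - q\<close> is the sum of the orthogonal functions \<open>f - p\<close> and \<open>p - q\<close>.
\<close>

lemma orthogonal_best_approx:
  fixes f :: "'a \<Rightarrow> real"
  assumes S: "\<And>s. s \<in> S \<Longrightarrow> sq_int M s" and f: "sq_int M f"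
    and p: "p \<in> lspan S" "\<And>s. s \<in> S \<Longrightarrow> (LINT x|M. (f x - p x) * s x) = 0" and q: "q \<in> lspan S"
  shows "(LINT x|M. (f x - p x) * (f x - p x)) \<le> (LINT x|M. (f x - q x) * (f x - q x))"
proof -
  define d where "d x = p x - q x" for x
  define r where "r x = f x - p x" for x
  have sq: "sq_int M r" "sq_int M d"
    using sq_int_lspan[OF S p(1)] sq_int_lspan[OF S q] f by (auto simp: r_def[abs_def] d_def[abs_def])
  have "(LINT x|M. r x * d x) = 0"
    unfolding d_def using p(2)
    by (intro orthogonal_lspan[OF S sq(1) _ lspan_diff[OF p(1) q]]) (simp_all add: r_def)
  moreover have "(f x - q x) * (f x - q x) = r x * r x + 2 * (r x * d x) + d x * d x" for x
    by (simp add: r_def d_def algebra_simps)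
  then have "(LINT x|M. (f x - q x) * (f x - q x))
      = (LINT x|M. r x * r x) + 2 * (LINT x|M. r x * d x) + (LINT x|M. d x * d x)"
    using sq_int_inner[OF sq] sq_int_square[OF sq(1)] sq_int_square[OF sq(2)] by simp
  moreover have "0 \<le> (LINT x|M. d x * d x)"
    by (intro Bochner_Integration.integral_nonneg) simp
  ultimately show ?thesis
    by (simp add: r_def)
qed

section \<open>Trigonometric polynomials on the periodic box\<close>

locale periodic_box =
  fixes a b :: "real^'d"
  assumes side_pos: "a $ i < b $ i"
begin

abbreviation "M \<equiv> lebesgue_on (box a b)"

lemma finite_measure_box: "finite_measure M"
  by (intro finite_measureI) (simp add: emeasure_restrict_space emeasure_lborel_box_eq)

lemma borel_measurable_M: "f \<in> borel_measurable lebesgue \<Longrightarrow> f \<in> borel_measurable M"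
  by (rule measurable_restrict_space1)

lemma continuous_borel_measurable_M:
  fixes f :: "real^'d \<Rightarrow> 'e::euclidean_space"
  assumes "continuous_on UNIV f"
  shows "f \<in> borel_measurable M"
  using borel_measurable_continuous_onI[OF assms]
  by (intro borel_measurable_M) (simp add: measurable_completion)

lemma sq_int_bounded:
  fixes f :: "real^'d \<Rightarrow> 'e::euclidean_space"
  assumes "f \<in> borel_measurable M" "\<And>x. x \<in> box a b \<Longrightarrow> norm (f x) \<le> B"
  shows "sq_int M f"
  unfolding sq_int_def
proof (intro conjI assms(1))
  interpret finite_measure M
    by (rule finite_measure_box)
  show "integrable M (\<lambda>x. f x \<bullet> f x)"
  proof (rule integrable_const_bound)
    show "AE x in M. norm (f x \<bullet> f x) \<le> B\<^sup>2"
      using assms(2) by (intro AE_I2) (auto simp: dot_square_norm intro!: power_mono)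
  qed (use assms(1) in simp)
qed

lemma sq_int_continuous:
  fixes f :: "real^'d \<Rightarrow> 'e::euclidean_space"
  assumes "continuous_on UNIV f"
  shows "sq_int M f"
proof -
  have "bounded (f ` cbox a b)"
    using assms by (intro compact_imp_bounded compact_continuous_image)
      (auto intro: continuous_on_subset)
  then obtain B where "\<And>x. x \<in> cbox a b \<Longrightarrow> norm (f x) \<le> B"
    by (auto simp: bounded_iff)
  then show ?thesis
    using box_subset_cbox[of a b]
    by (intro sq_int_bounded[where B = B] continuous_borel_measurable_M assms) auto
qed

lemma sq_int_trig_poly: "f \<in> trig_poly a b \<Longrightarrow> sq_int M f"
  using Ck_trig_poly[of f a b 0] by (intro sq_int_continuous) simp

lemma sq_int_1: "sq_int M (\<lambda>x. 1::real)"
  by (rule sq_int_continuous) (rule continuous_on_const)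

lemma integrable_trig_poly: "f \<in> trig_poly a b \<Longrightarrow> integrable M f"
  using sq_int_inner[OF sq_int_trig_poly sq_int_1, of f] by simp

lemma integral_cis_interval:
  fixes l u c :: real
  assumes "l \<le> u" "c \<noteq> 0"
  shows "(LINT t|lborel. indicator {l..u} t *\<^sub>R cis (c * t)) = (cis (c * u) - cis (c * l)) / (\<i> * c)"
proof -
  have "((\<lambda>t. cis (c * t) / (\<i> * c)) has_vector_derivative cis (c * t)) (at t within {l..u})" for t
  proof -
    have "((\<lambda>z. exp (\<i> * c * z) / (\<i> * c)) has_field_derivative exp (\<i> * c * t)) (at (of_real t))"
      using assms(2) by (auto intro!: derivative_eq_intros)
    from has_vector_derivative_real_field[OF this] show ?thesis
      by (simp add: cis_conv_exp mult.assoc)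
  qed
  from integral_FTC_Icc[OF assms(1) this] show ?thesis
    by (simp add: diff_divide_distrib continuous_intros)
qed

text \<open>
  The plane wave is a product of functions of one coordinate, so its integral is a product of
  integrals over the sides of the box. The wave vector has a nonzero component, and in this direction
  the side is a whole number of periods.
\<close>

lemma integral_cis_freq:
  assumes "k \<noteq> 0"
  shows "(LINT x|M. cis (freq a b k \<bullet> x)) = 0"
proof -
  let ?c = "freq a b k"
  obtain i where i: "k $ i \<noteq> 0"
    using assms by (auto simp: vec_eq_iff)
  define f where "f e t = indicator {a \<bullet> e..b \<bullet> e} t *\<^sub>R cis ((?c \<bullet> e) * t)" for e and t :: real
  have prod: "indicator (cbox a b) x *\<^sub>R cis (?c \<bullet> x) = (\<Prod>e\<in>Basis. f e (x \<bullet> e))" for x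
  proof -
    have "cis (?c \<bullet> x) = (\<Prod>e\<in>Basis. cis ((?c \<bullet> e) * (x \<bullet> e)))"
      by (subst euclidean_inner) (simp add: cis_conv_exp sum_distrib_left exp_sum)
    moreover have "indicator (cbox a b) x = (\<Prod>e\<in>Basis. indicator {a \<bullet> e..b \<bullet> e} (x \<bullet> e) :: real)"
      by (auto simp: indicator_def cbox_def prod.neutral)
    ultimately show ?thesis
      by (simp add: f_def scaleR_conv_of_real prod.distrib)
  qed
  interpret product_sigma_finite "\<lambda>_::real^'d. lborel :: real measure" ..
  have int_f: "integrable lborel (f e)" for e
    unfolding f_def[abs_def] by (rule borel_integrable_compact) (auto intro!: continuous_intros)
  \<comment> \<open>The closed box is a product of closed intervals, to which the fundamental theorem of calculus applies.\<close>
  have "AE x in lebesgue. indicator (box a b) x *\<^sub>R cis (?c \<bullet> x) = indicator (cbox a b) x *\<^sub>R cis (?c \<bullet> x)"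
  proof (rule AE_I')
    show "cbox a b - box a b \<in> null_sets lebesgue"
      using negligible_frontier_interval negligible_iff_null_sets by blast
  qed (use box_subset_cbox[of a b] in \<open>auto simp: indicator_def split: if_splits\<close>)
  then have "(LINT x|M. cis (?c \<bullet> x)) = (LINT x|lebesgue. indicator (cbox a b) x *\<^sub>R cis (?c \<bullet> x))"
    by (subst integral_restrict_space, simp, intro integral_cong_AE)
       (auto intro!: measurable_completion borel_measurable_scaleR borel_measurable_indicator
             borel_measurable_continuous_onI[of "\<lambda>x. cis (?c \<bullet> x)"] continuous_intros)
  also have "\<dots> = (LINT x|lborel. (\<Prod>e\<in>Basis. f e (x \<bullet> e)))"
    unfolding prod by (rule integral_completion) (use int_f in measurable)
  also have "\<dots> = (LINT y|(\<Pi>\<^sub>M e\<in>Basis. lborel). (\<Prod>e\<in>Basis. f e ((\<Sum>b\<in>Basis. y b *\<^sub>R b) \<bullet> e)))"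
    unfolding lborel_eq[where 'a = "real^'d"] by (rule integral_distr) (use int_f in measurable)
  also have "\<dots> = (LINT y|(\<Pi>\<^sub>M e\<in>Basis. lborel). (\<Prod>e\<in>Basis. f e (y e)))"
    by (intro Bochner_Integration.integral_cong prod.cong refl)
       (simp add: inner_sum_left inner_Basis if_distrib cong: if_cong)
  also have "\<dots> = (\<Prod>e\<in>Basis. integral\<^sup>L lborel (f e))"
    by (rule product_integral_prod) (use int_f in auto)
  also have "\<dots> = 0"
  proof (rule prod_zero)
    let ?i = "axis i 1 :: real^'d"
    have c: "?c $ i \<noteq> 0" and cd: "?c $ i * b $ i = ?c $ i * a $ i + 2 * pi * of_int (k $ i)"
      using i side_pos[of i] by (auto simp: freq_def field_simps)
    have "cis (?c $ i * b $ i) = cis (?c $ i * a $ i)"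
      unfolding cd by (simp add: cis.ctr cos_add sin_add)
    then have "integral\<^sup>L lborel (f ?i) = 0"
      using integral_cis_interval[of "a $ i" "b $ i" "?c $ i"] side_pos[of i] c
      by (simp add: f_def[abs_def] inner_axis)
    then show "\<exists>e\<in>Basis. integral\<^sup>L lborel (f e) = 0"
      by (intro bexI[of _ ?i]) (auto simp: Basis_vec_def)
  qed simp
  finally show ?thesis .
qed

lemma integral_modes:
  assumes "k \<noteq> 0"
  shows "(LINT x|M. cos_mode a b k x) = 0" "(LINT x|M. sin_mode a b k x) = 0"
proof -
  have int: "integrable M (cos_mode a b k)" "integrable M (sin_mode a b k)"
    by (auto intro!: integrable_trig_poly cos_mode_in_trig_poly sin_mode_in_trig_poly)
  have eq: "cis (freq a b k \<bullet> x) = of_real (cos_mode a b k x) + \<i> * of_real (sin_mode a b k x)" for x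
    by (simp add: cos_mode_def sin_mode_def cis.ctr complex_eq_iff)
  have "Complex (LINT x|M. cos_mode a b k x) (LINT x|M. sin_mode a b k x) = 0"
    using integral_cis_freq[OF assms] int unfolding eq by (simp add: complex_eq_iff)
  then show "(LINT x|M. cos_mode a b k x) = 0" "(LINT x|M. sin_mode a b k x) = 0"
    by (auto simp: complex_eq_iff)
qed

lemma integral_pderiv_trig_poly:
  assumes "f \<in> trig_poly a b"
  shows "(LINT x|M. pderiv i f x) = 0"
  using assms
proof induction
  case (step s f c)
  have s: "s \<in> trig_poly a b"
    using step.hyps(1) by (rule lspan_base)
  have "pderiv i (\<lambda>x. c * s x + f x) x = c * pderiv i s x + pderiv i f x" for x
    using differentiable_trig_poly[OF s] differentiable_trig_poly[OF step.hyps(2)]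
    by (simp add: pderiv_add pderiv_cmult)
  moreover have "(LINT x|M. pderiv i s x) = 0"
    using step.hyps(1)
  proof (cases rule: modes_cases)
    case (1 k)
    then show ?thesis
      by (cases "k = 0") (simp_all add: pderiv_modes integral_modes freq_def)
  next
    case (2 k)
    then show ?thesis
      by (cases "k = 0") (simp_all add: pderiv_modes integral_modes freq_def)
  qed
  moreover have "integrable M (pderiv i s)" "integrable M (pderiv i f)"
    using s step.hyps(2) by (auto intro!: integrable_trig_poly pderiv_trig_poly)
  ultimately show ?case
    using step.IH by simp
qed simp

text \<open>
  No boundary terms arise: products of trigonometric polynomials are trigonometric polynomials, and
  the derivative of a nonconstant mode has mean zero.
\<close>

lemma trig_poly_by_parts:
  assumes "f \<in> trig_poly a b" "g \<in> trig_poly a b"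
  shows "(LINT x|M. pderiv i f x * g x) = - (LINT x|M. f x * pderiv i g x)"
proof -
  have "pderiv i (\<lambda>x. f x * g x) x = pderiv i f x * g x + f x * pderiv i g x" for x
    using assms by (intro pderiv_mult differentiable_trig_poly)
  moreover have "integrable M (\<lambda>x. pderiv i f x * g x)" "integrable M (\<lambda>x. f x * pderiv i g x)"
    using assms by (auto intro!: integrable_trig_poly trig_poly_mult pderiv_trig_poly)
  ultimately show ?thesis
    using integral_pderiv_trig_poly[OF trig_poly_mult[OF assms], of i] by simp
qed

section \<open>Density of trigonometric polynomials\<close>

text \<open>
  Stone-Weierstrass demands functions that separate points, whereas trigonometric polynomials agree
  on opposite faces of the closed box. This map glues these faces; its image is a compact set on which
  the coordinate functions do separate points, and composed with the map they are modes.
\<close>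

definition torus :: "real^'d \<Rightarrow> (real^'d) \<times> (real^'d)" where
  "torus x = ((\<chi> i. cos (freq a b (axis i 1) \<bullet> x)), (\<chi> i. sin (freq a b (axis i 1) \<bullet> x)))"

lemma freq_axis: "freq a b (axis i 1) \<bullet> x = 2 * pi / (b $ i - a $ i) * x $ i"
proof -
  have "freq a b (axis i 1) = (2 * pi / (b $ i - a $ i)) *\<^sub>R axis i 1"
    by (simp add: freq_def vec_eq_iff axis_def)
  then show ?thesis
    by (simp add: inner_axis')
qed

lemma continuous_on_torus: "continuous_on S torus"
  unfolding torus_def[abs_def] by (intro continuous_intros)

lemma torus_eqD:
  assumes "torus x = torus y" "x \<in> cbox a b" "y \<in> cbox a b" "x \<noteq> y"
  shows "x \<notin> box a b"
proof
  assume x: "x \<in> box a b"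
  have "x $ i = y $ i" for i
  proof -
    let ?L = "b $ i - a $ i"
    have L: "?L > 0"
      using side_pos[of i] by simp
    have "cos (2 * pi / ?L * x $ i) = cos (2 * pi / ?L * y $ i)"
      "sin (2 * pi / ?L * x $ i) = sin (2 * pi / ?L * y $ i)"
      using assms(1) by (auto simp: torus_def vec_eq_iff freq_axis)
    then obtain n :: int where "2 * pi / ?L * x $ i = 2 * pi / ?L * y $ i + 2 * pi * n"
      using sin_cos_eq_iff by metis
    then have "2 * pi * x $ i = 2 * pi * (y $ i + n * ?L)"
      using L by (simp add: field_simps)
    then have n: "x $ i = y $ i + n * ?L"
      by simp
    have "a $ i < x $ i" "x $ i < b $ i" "a $ i \<le> y $ i" "y $ i \<le> b $ i"
      using x assms(3) by (auto simp: mem_box_cart)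
    then have "\<bar>x $ i - y $ i\<bar> < 1 * ?L"
      by (auto simp: abs_less_iff)
    then have "\<bar>of_int n * ?L\<bar> < 1 * ?L"
      using n by simp
    then have "\<bar>real_of_int n\<bar> < 1"
      using L by (simp add: abs_mult)
    then have "n = 0"
      by linarith
    then show ?thesis
      using n by simp
  qed
  then show False
    using assms(4) by (simp add: vec_eq_iff)
qed

lemma polynomial_of_torus:
  assumes "real_polynomial_function q"
  shows "(\<lambda>x. q (torus x)) \<in> trig_poly a b"
  using assms
proof induction
  case (linear f)
  have sum: "(\<lambda>x. \<Sum>i\<in>I. g i x) \<in> trig_poly a b" if "\<And>i. g i \<in> trig_poly a b" for g and I :: "'d set"
    by (induction I rule: infinite_finite_induct) (auto intro: lspan.zero lspan_add that)
  have "f (torus x) = (\<Sum>i\<in>UNIV. f (axis i 1, 0) * cos_mode a b (axis i 1) x)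
      + (\<Sum>i\<in>UNIV. f (0, axis i 1) * sin_mode a b (axis i 1) x)" for x
  proof -
    interpret f: bounded_linear f by fact
    have "torus x = (\<Sum>i\<in>UNIV. cos_mode a b (axis i 1) x *\<^sub>R (axis i 1, 0))
        + (\<Sum>i\<in>UNIV. sin_mode a b (axis i 1) x *\<^sub>R (0, axis i 1))"
      by (simp add: torus_def prod_eq_iff fst_sum snd_sum vec_eq_iff cos_mode_def sin_mode_def
          axis_def if_distrib cong: if_cong)
    then show ?thesis
      by (simp add: f.add f.sum f.scaleR mult.commute del: scaleR_Pair)
  qed
  then show ?case
    by (auto intro!: lspan_add sum lspan_scale cos_mode_in_trig_poly sin_mode_in_trig_poly)
qed (auto intro: trig_poly_const lspan_add trig_poly_mult)

text \<open>
  A function that vanishes outside the box takes the same value on glued points, so it factors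
  through \<open>torus\<close>. The factor \<open>g\<close> is continuous because preimages of closed sets under \<open>g\<close> are
  images under \<open>torus\<close> of compact sets.
\<close>

lemma trig_poly_uniform_approx:
  fixes h :: "real^'d \<Rightarrow> real"
  assumes cont: "continuous_on UNIV h" and zero: "\<And>x. x \<notin> box a b \<Longrightarrow> h x = 0" and "0 < e"
  obtains q where "q \<in> trig_poly a b" "\<And>x. x \<in> cbox a b \<Longrightarrow> \<bar>h x - q x\<bar> < e"
proof -
  let ?T = "torus ` cbox a b"
  have compact: "compact ?T"
    by (intro compact_continuous_image continuous_on_torus compact_cbox)
  define g where "g z = h (SOME x. x \<in> cbox a b \<and> torus x = z)" for z
  have g: "g (torus x) = h x" if "x \<in> cbox a b" for x
  proof -
    define y where "y = (SOME y. y \<in> cbox a b \<and> torus y = torus x)"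
    have y: "y \<in> cbox a b" "torus y = torus x"
      using someI[of "\<lambda>y. y \<in> cbox a b \<and> torus y = torus x" x] that by (auto simp: y_def)
    show ?thesis
    proof (cases "y = x")
      case True
      then show ?thesis
        by (simp add: g_def flip: y_def)
    next
      case False
      then show ?thesis
        using torus_eqD[OF y(2) y(1) that] torus_eqD[OF y(2)[symmetric] that y(1)] zero
        by (simp add: g_def flip: y_def)
    qed
  qed
  have "continuous_on ?T g"
  proof (subst continuous_on_closed_vimage[OF compact_imp_closed[OF compact]], intro allI impI)
    fix B :: "real set"
    assume "closed B"
    then have "closed (h -` B)"
      using cont continuous_on_closed_vimage[of UNIV h] by simp
    then have "compact (h -` B \<inter> cbox a b)"
      by (simp add: closed_Int_compact)
    then have "closed (torus ` (h -` B \<inter> cbox a b))"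
      by (intro compact_imp_closed compact_continuous_image continuous_on_torus)
    moreover have "g -` B \<inter> ?T = torus ` (h -` B \<inter> cbox a b)"
      using g by auto
    ultimately show "closed (g -` B \<inter> ?T)"
      by simp
  qed
  from Stone_Weierstrass_real_polynomial_function[OF compact this \<open>0 < e\<close>]
  obtain q where q: "real_polynomial_function q" "\<And>z. z \<in> ?T \<Longrightarrow> \<bar>g z - q z\<bar> < e"
    by blast
  show thesis
    using polynomial_of_torus[OF q(1)] q(2) g by (intro that[of "\<lambda>x. q (torus x)"]) fastforce+
qed

text \<open>
  A measurable function is an almost everywhere limit of continuous functions. Clipping at \<open>B\<close> gives
  a dominating constant, and the cutoff, which tends to 1 inside the open box, makes the
  approximants vanish outside.
\<close>

lemma continuous_L2_approx:
  fixes f :: "real^'d \<Rightarrow> real"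
  assumes meas: "f \<in> borel_measurable M" and bound: "\<And>x. \<bar>f x\<bar> \<le> B"
  obtains h where "\<And>n. continuous_on UNIV (h n)" "\<And>n x. x \<notin> box a b \<Longrightarrow> h n x = 0"
    "L2_tendsto M h f"
proof -
  have "f measurable_on box a b"
    using meas by (subst measurable_on_iff_borel_measurable) auto
  then obtain N g where N: "negligible N" and g: "\<And>n. continuous_on UNIV (g n)"
    and lim: "\<And>x. x \<notin> N \<Longrightarrow> (\<lambda>n. g n x) \<longlonglongrightarrow> (if x \<in> box a b then f x else 0)"
    unfolding measurable_on_def by metis
  have "B \<ge> 0"
    using bound[of 0] by linarith
  define cut where "cut n x = min 1 (real n * infdist x (- box a b))" for n x
  define h where "h n x = cut n x * max (- B) (min B (g n x))" for n x
  have ne: "- box a b \<noteq> {}"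
    using bounded_box[of a b] not_bounded_UNIV by (metis Compl_empty_eq double_compl)
  have cut: "0 \<le> cut n x" "cut n x \<le> 1" for n x
    by (auto simp: cut_def infdist_nonneg)
  have h_bound: "\<bar>h n x\<bar> \<le> B" for n x
  proof -
    have "\<bar>h n x\<bar> \<le> 1 * B"
      unfolding h_def abs_mult using cut[of n x] \<open>B \<ge> 0\<close> by (intro mult_mono) auto
    then show ?thesis
      by simp
  qed
  have cont: "continuous_on UNIV (h n)" for n
    unfolding h_def[abs_def] cut_def[abs_def] by (intro continuous_intros g)
  have "L2_tendsto M h f"
  proof (rule L2_tendsto_dominated[where g = "\<lambda>x. B"])
    show "h n \<in> borel_measurable M" for n
      by (rule continuous_borel_measurable_M[OF cont])
    show "sq_int M (\<lambda>x. B)"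
      by (rule sq_int_continuous) (rule continuous_on_const)
    have "AE x in lebesgue. x \<notin> N"
      using N by (simp add: negligible_iff_null_sets AE_not_in)
    then have "AE x in M. x \<notin> N"
      by (subst AE_restrict_space_iff) auto
    then show "AE x in M. (\<lambda>n. h n x) \<longlonglongrightarrow> f x"
      using AE_space[of M]
    proof eventually_elim
      case (elim x)
      then have x: "x \<in> box a b"
        by simp
      have "infdist x (- box a b) > 0"
        using x ne infdist_nonneg[of x "- box a b"] in_closed_iff_infdist_zero[of "- box a b" x]
        by (auto simp: less_le open_box closed_Compl)
      then have "(\<lambda>n. cut n x) \<longlonglongrightarrow> 1"
        unfolding cut_def by real_asymp
      moreover have "(\<lambda>n. max (- B) (min B (g n x))) \<longlonglongrightarrow> max (- B) (min B (f x))"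
        using lim[OF elim(1)] x by (intro tendsto_intros) auto
      moreover have "max (- B) (min B (f x)) = f x"
        using bound[of x] by auto
      ultimately show ?case
        unfolding h_def using tendsto_mult by fastforce
    qed
  qed (use meas h_bound \<open>B \<ge> 0\<close> in auto)
  moreover have "h n x = 0" if "x \<notin> box a b" for n x
    using that by (simp add: h_def cut_def)
  ultimately show thesis
    using that cont by blast
qed

text \<open>
  Chain the continuous approximation in mean square with the uniform one, half of the error each.
\<close>

lemma trig_poly_dense_bounded:
  fixes f :: "real^'d \<Rightarrow> real"
  assumes meas: "f \<in> borel_measurable M" and bound: "\<And>x. \<bar>f x\<bar> \<le> B" and "0 < e"
  shows "\<exists>q\<in>trig_poly a b. (LINT x|M. (f x - q x) * (f x - q x)) < e"
proof -
  obtain h where h: "\<And>n. continuous_on UNIV (h n)" "\<And>n x. x \<notin> box a b \<Longrightarrow> h n x = 0"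
    and lim: "L2_tendsto M h f"
    using continuous_L2_approx[OF meas bound] by blast
  then have "(\<lambda>n. LINT x|M. (h n x - f x) * (h n x - f x)) \<longlonglongrightarrow> 0"
    by (simp add: L2_tendsto_def)
  then have "eventually (\<lambda>n. (LINT x|M. (h n x - f x) * (h n x - f x)) < e / 4) sequentially"
    by (rule order_tendstoD) (use \<open>0 < e\<close> in simp)
  then obtain n where "(LINT x|M. (h n x - f x) * (h n x - f x)) < e / 4"
    by (auto simp: eventually_sequentially)
  then have n: "(LINT x|M. (f x - h n x) * (f x - h n x)) < e / 4"
    by (simp add: algebra_simps)
  define V where "V = measure M (space M)"
  have "V \<ge> 0"
    by (simp add: V_def)
  \<comment> \<open>A uniform error \<open>d\<close> contributes at most \<open>d\<^sup>2 * V\<close>; the summand 1 makes the inequality below strict.\<close>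
  define d where "d = sqrt (e / (4 * (V + 1)))"
  have d: "0 < d"
    using \<open>0 < e\<close> \<open>V \<ge> 0\<close> by (simp add: d_def)
  have "d\<^sup>2 = e / (4 * (V + 1))"
    using \<open>0 < e\<close> \<open>V \<ge> 0\<close> by (simp add: d_def)
  then have "d\<^sup>2 * V + d\<^sup>2 = e / 4"
    using \<open>V \<ge> 0\<close> by (simp add: field_simps)
  then have d_V: "d\<^sup>2 * V < e / 4"
    using d zero_less_power[OF d, of 2] by linarith
  obtain q where q: "q \<in> trig_poly a b" "\<And>x. x \<in> cbox a b \<Longrightarrow> \<bar>h n x - q x\<bar> < d"
    using trig_poly_uniform_approx[OF h d] by blast
  interpret finite_measure M
    by (rule finite_measure_box)
  have sq: "sq_int M (h n)" "sq_int M q" "sq_int M f"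
    using sq_int_continuous[OF h(1)] sq_int_trig_poly[OF q(1)] lim by (auto simp: L2_tendsto_def)
  have "(LINT x|M. (h n x - q x) * (h n x - q x)) \<le> (LINT x|M. d\<^sup>2)"
  proof (rule integral_mono_AE)
    show "integrable M (\<lambda>x. (h n x - q x) * (h n x - q x))"
      using sq_int_square[OF sq_int_diff[OF sq(1,2)]] by simp
    have "(h n x - q x)\<^sup>2 \<le> d\<^sup>2" if "x \<in> box a b" for x
      using q(2)[of x] that box_subset_cbox[of a b] by (subst abs_le_square_iff[symmetric]) force
    then show "AE x in M. (h n x - q x) * (h n x - q x) \<le> d\<^sup>2"
      by (intro AE_I2) (simp add: power2_eq_square)
  qed simp
  also have "\<dots> < e / 4"
    using d_V by (simp add: V_def mult.commute)
  finally have "(LINT x|M. (f x - q x) * (f x - q x)) < e"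
    using L2_dist_triangle[OF sq(3,1,2)] n by simp
  then show ?thesis
    using q(1) by blast
qed

text \<open>
  Reduce to bounded functions by clipping.
\<close>

lemma trig_poly_dense:
  fixes f :: "real^'d \<Rightarrow> real"
  assumes f: "sq_int M f" and "0 < e"
  shows "\<exists>q\<in>trig_poly a b. (LINT x|M. (f x - q x) * (f x - q x)) < e"
proof -
  define g where "g n x = max (- real n) (min (real n) (f x))" for n x
  have meas: "g n \<in> borel_measurable M" for n
    using f by (auto simp: g_def[abs_def] sq_int_def)
  have "L2_tendsto M g f"
  proof (rule L2_tendsto_dominated[where g = f])
    show "AE x in M. (\<lambda>n. g n x) \<longlonglongrightarrow> f x"
    proof (intro AE_I2 tendsto_eventually)
      fix x
      obtain N where "\<bar>f x\<bar> \<le> real N"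
        using real_arch_simple by blast
      then have "g n x = f x" if "n \<ge> N" for n
        using that by (auto simp: g_def)
      then show "\<forall>\<^sub>F n in sequentially. g n x = f x"
        by (auto simp: eventually_sequentially)
    qed
  qed (use f meas in \<open>auto simp: sq_int_def g_def\<close>)
  then have "(\<lambda>n. LINT x|M. (g n x - f x) * (g n x - f x)) \<longlonglongrightarrow> 0" and sqg: "sq_int M (g n)" for n
    by (auto simp: L2_tendsto_def)
  then have "eventually (\<lambda>n. (LINT x|M. (g n x - f x) * (g n x - f x)) < e / 4) sequentially"
    by (intro order_tendstoD) (use \<open>0 < e\<close> in auto)
  then obtain n where "(LINT x|M. (g n x - f x) * (g n x - f x)) < e / 4"
    by (auto simp: eventually_sequentially)
  then have n: "(LINT x|M. (f x - g n x) * (f x - g n x)) < e / 4"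
    by (simp add: algebra_simps)
  have "\<bar>g n x\<bar> \<le> real n" for x
    by (auto simp: g_def)
  then obtain q where q: "q \<in> trig_poly a b" "(LINT x|M. (g n x - q x) * (g n x - q x)) < e / 4"
    using trig_poly_dense_bounded[OF meas, of n "real n" "e / 4"] \<open>0 < e\<close> by auto
  have "(LINT x|M. (f x - q x) * (f x - q x)) < e"
    using L2_dist_triangle[OF f sqg sq_int_trig_poly[OF q(1)], of n] n q(2) by simp
  then show ?thesis
    using q(1) by blast
qed

lemma sq_int_L2per: "f \<in> L2per a b \<Longrightarrow> sq_int M f"
  by (simp add: L2per_def sq_int_def borel_measurable_M)

text \<open>
  Approximate \<open>f\<close> and all components of \<open>g\<close> separately by trigonometric polynomials and let \<open>S\<close> be
  the finite set of all modes that occur. The projection \<open>p\<close> of \<open>f\<close> onto the span of \<open>S\<close> is at least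
  as close to \<open>f\<close> as the first approximant. For \<open>s\<close> in \<open>S\<close>, integration by parts for \<open>p\<close> and the
  definition of the weak gradient for \<open>f\<close> turn the pairing of \<open>g $ i - pderiv i p\<close> with \<open>s\<close> into that of
  \<open>f - p\<close> with \<open>pderiv i s\<close>, which again lies in the span; so it is zero. Hence \<open>pderiv i p\<close> is the
  projection of \<open>g $ i\<close> and beats the approximant of \<open>g $ i\<close>.
\<close>

lemma trig_poly_dense_H1:
  assumes f: "sq_int M f" and g: "has_weak_grad a b f g" and "0 < e"
  shows "\<exists>q\<in>trig_poly a b. (LINT x|M. (f x - q x) * (f x - q x)) < e \<and>
    (\<forall>i. (LINT x|M. (g x $ i - pderiv i q x) * (g x $ i - pderiv i q x)) < e)"
proof -
  have sqg: "sq_int M (\<lambda>x. g x $ i)" for i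
    using g by (auto simp: has_weak_grad_def intro!: sq_int_vec_nth[OF sq_int_L2per])
  obtain q0 where q0: "q0 \<in> trig_poly a b" "(LINT x|M. (f x - q0 x) * (f x - q0 x)) < e"
    using trig_poly_dense[OF f \<open>0 < e\<close>] by blast
  have "\<exists>q. \<forall>i. q i \<in> trig_poly a b \<and> (LINT x|M. (g x $ i - q i x) * (g x $ i - q i x)) < e"
    using trig_poly_dense[OF sqg \<open>0 < e\<close>] by (intro choice allI) blast
  then obtain q where q: "\<And>i. q i \<in> trig_poly a b"
    "\<And>i. (LINT x|M. (g x $ i - q i x) * (g x $ i - q i x)) < e"
    by blast
  obtain K0 where K0: "finite K0" "q0 \<in> lspan (modes a b K0)"
    using lspan_finite[OF q0(1)] by blast
  have "\<exists>K. \<forall>i. finite (K i) \<and> q i \<in> lspan (modes a b (K i))"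
    using lspan_finite[OF q(1)] by (intro choice allI)
  then obtain K where K: "\<And>i. finite (K i)" "\<And>i. q i \<in> lspan (modes a b (K i))"
    by blast
  define S where "S = modes a b (K0 \<union> (\<Union>i. K i))"
  have fin: "finite S"
    using K0 K by (auto simp: S_def intro!: finite_modes)
  have inS: "q0 \<in> lspan S" "q i \<in> lspan S" for i
    unfolding S_def using K0(2) K(2)[of i] by (auto elim!: lspan_mono[OF modes_mono, rotated])
  have S_trig: "p \<in> trig_poly a b" if "p \<in> lspan S" for p
    using lspan_mono[OF modes_mono[OF subset_UNIV] that[unfolded S_def]] .
  have S_base: "s \<in> trig_poly a b" if "s \<in> S" for s
    using S_trig lspan_base that by blast
  have S: "sq_int M s" if "s \<in> S" for s
    using S_base[OF that] by (rule sq_int_trig_poly)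
  obtain p where p: "p \<in> lspan S" "\<And>s. s \<in> S \<Longrightarrow> (LINT x|M. (f x - p x) * s x) = 0"
    using L2_projection_exists[OF fin S f] by blast
  have sqp: "sq_int M p" "sq_int M (pderiv i p)" for i
    using p(1) by (auto intro!: sq_int_trig_poly S_trig pderiv_trig_poly)
  have dS: "pderiv i r \<in> lspan S" if "r \<in> lspan S" for i r
    using that unfolding S_def by (rule pderiv_trig_poly)
  have grad_orth: "(LINT x|M. (g x $ i - pderiv i p x) * s x) = 0" if s: "s \<in> S" for i s
  proof -
    have ds: "pderiv i s \<in> lspan S"
      using s by (intro dS lspan_base)
    have "s \<in> Cinf_per a b"
      using S_base[OF s] side_pos by (intro trig_poly_in_Cinf_per)
    then have 1: "(LINT x|M. g x $ i * s x) = - (LINT x|M. f x * pderiv i s x)"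
      using g by (auto simp: has_weak_grad_def ip_def)
    have 2: "(LINT x|M. pderiv i p x * s x) = - (LINT x|M. p x * pderiv i s x)"
      using S_trig[OF p(1)] S_base[OF s] by (rule trig_poly_by_parts)
    have 3: "(LINT x|M. (f x - p x) * pderiv i s x) = 0"
      by (rule orthogonal_lspan[OF S _ p(2) ds]) (use f sqp in auto)
    have sqs: "sq_int M s" "sq_int M (pderiv i s)"
      using S[OF s] S_trig[OF ds] by (auto intro: sq_int_trig_poly)
    have int: "integrable M (\<lambda>x. g x $ i * s x)" "integrable M (\<lambda>x. pderiv i p x * s x)"
      "integrable M (\<lambda>x. f x * pderiv i s x)" "integrable M (\<lambda>x. p x * pderiv i s x)"
      using sq_int_inner[OF sqg sqs(1)] sq_int_inner[OF sqp(2) sqs(1)] sq_int_inner[OF f sqs(2)]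
        sq_int_inner[OF sqp(1) sqs(2)] by simp_all
    show ?thesis
      using 1 2 3 int by (simp add: left_diff_distrib)
  qed
  have "(LINT x|M. (f x - p x) * (f x - p x)) < e"
    using orthogonal_best_approx[OF S f p inS(1)] q0(2) by linarith
  moreover have "(LINT x|M. (g x $ i - pderiv i p x) * (g x $ i - pderiv i p x)) < e" for i
    using orthogonal_best_approx[where S = S and f = "\<lambda>x. g x $ i", OF S sqg dS[OF p(1)] grad_orth inS(2)[of i]]
      q(2)[of i] by simp
  ultimately show ?thesis
    using S_trig[OF p(1)] by blast
qed

lemma trig_poly_H1_sequence:
  assumes f: "sq_int M f" and g: "has_weak_grad a b f g"
  obtains q where "\<And>n. q n \<in> trig_poly a b" "L2_tendsto M q f"
    "\<And>i. L2_tendsto M (\<lambda>n. pderiv i (q n)) (\<lambda>x. g x $ i)"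
proof -
  have "\<exists>q. \<forall>n. q n \<in> trig_poly a b \<and>
    (LINT x|M. (f x - q n x) * (f x - q n x)) < inverse (real (Suc n)) \<and>
    (\<forall>i. (LINT x|M. (g x $ i - pderiv i (q n) x) * (g x $ i - pderiv i (q n) x)) < inverse (real (Suc n)))"
  proof (intro choice allI)
    fix n
    show "\<exists>q. q \<in> trig_poly a b \<and>
      (LINT x|M. (f x - q x) * (f x - q x)) < inverse (real (Suc n)) \<and>
      (\<forall>i. (LINT x|M. (g x $ i - pderiv i q x) * (g x $ i - pderiv i q x)) < inverse (real (Suc n)))"
      using trig_poly_dense_H1[OF assms, of "inverse (real (Suc n))"] by auto
  qed
  then obtain q where q: "\<And>n. q n \<in> trig_poly a b"
    "\<And>n. (LINT x|M. (f x - q n x) * (f x - q n x)) < inverse (real (Suc n))"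
    "\<And>n i. (LINT x|M. (g x $ i - pderiv i (q n) x) * (g x $ i - pderiv i (q n) x)) < inverse (real (Suc n))"
    by blast
  have lim: "L2_tendsto M F h" if F: "\<And>n. sq_int M (F n)" and h: "sq_int M h"
    and less: "\<And>n. (LINT x|M. (h x - F n x) * (h x - F n x)) < inverse (real (Suc n))"
    for F and h :: "real^'d \<Rightarrow> real"
  proof -
    have eq: "(F n x - h x) * (F n x - h x) = (h x - F n x) * (h x - F n x)" for n x
      by (simp add: algebra_simps)
    have "(\<lambda>n. LINT x|M. (h x - F n x) * (h x - F n x)) \<longlonglongrightarrow> 0"
      by (rule tendsto_sandwich[OF _ _ tendsto_const LIMSEQ_inverse_real_of_nat])
         (use less in \<open>auto intro!: always_eventually less_imp_le Bochner_Integration.integral_nonneg\<close>)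
    then show ?thesis
      using F h by (simp add: L2_tendsto_def eq)
  qed
  have sqg: "sq_int M (\<lambda>x. g x $ i)" for i
    using g by (auto simp: has_weak_grad_def intro!: sq_int_vec_nth[OF sq_int_L2per])
  show thesis
  proof (rule that[OF q(1)])
    show "L2_tendsto M q f"
      using q by (intro lim f sq_int_trig_poly)
    show "L2_tendsto M (\<lambda>n. pderiv i (q n)) (\<lambda>x. g x $ i)" for i
      using q(3) by (intro lim sqg sq_int_trig_poly[OF pderiv_trig_poly[OF q(1)]])
  qed
qed

section \<open>Weak gradients\<close>

text \<open>
  Orthogonality to \<open>q\<close> makes the squared distance from \<open>w\<close> to \<open>q\<close> at least the squared norm of \<open>w\<close>,
  while by density the distance can be made arbitrarily small.
\<close>

lemma AE_zero_if_orthogonal: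
  fixes w :: "real^'d \<Rightarrow> real"
  assumes w: "sq_int M w" and orth: "\<And>q. q \<in> trig_poly a b \<Longrightarrow> (LINT x|M. w x * q x) = 0"
  shows "AE x in M. w x = 0"
proof -
  have "(LINT x|M. w x * w x) \<le> 0 + e" if e: "e > 0" for e :: real
  proof -
    obtain q where q: "q \<in> trig_poly a b" "(LINT x|M. (w x - q x) * (w x - q x)) < e"
      using trig_poly_dense[OF w e] by blast
    have sq: "sq_int M q"
      using q(1) by (rule sq_int_trig_poly)
    have "(w x - q x) * (w x - q x) = w x * w x - 2 * (w x * q x) + q x * q x" for x
      by (simp add: algebra_simps)
    then have "(LINT x|M. (w x - q x) * (w x - q x))
        = (LINT x|M. w x * w x) - 2 * (LINT x|M. w x * q x) + (LINT x|M. q x * q x)"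
      using sq_int_square[OF w] sq_int_square[OF sq] sq_int_inner[OF w sq] by simp
    moreover have "0 \<le> (LINT x|M. q x * q x)"
      by (intro Bochner_Integration.integral_nonneg) simp
    ultimately show ?thesis
      using q orth[OF q(1)] by linarith
  qed
  then have "(LINT x|M. w x * w x) \<le> 0"
    by (rule field_le_epsilon)
  moreover have "0 \<le> (LINT x|M. w x * w x)"
    by (intro Bochner_Integration.integral_nonneg) simp
  ultimately have "(LINT x|M. w x * w x) = 0"
    by linarith
  then have "AE x in M. w x * w x = 0"
    using sq_int_square[OF w] by (subst (asm) integral_nonneg_eq_0_iff_AE) auto
  then show ?thesis
    by simp
qed

lemma sq_int_weak_grad: "has_weak_grad a b f g \<Longrightarrow> sq_int M g"
  by (auto simp: has_weak_grad_def intro: sq_int_L2per)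

lemma weak_grad_unique:
  assumes "has_weak_grad a b f g" "has_weak_grad a b f h"
  shows "AE x in M. g x = h x"
proof -
  have "AE x in M. g x $ i - h x $ i = 0" for i
  proof (rule AE_zero_if_orthogonal)
    have sq: "sq_int M (\<lambda>x. g x $ i)" "sq_int M (\<lambda>x. h x $ i)"
      using assms by (auto intro: sq_int_vec_nth sq_int_weak_grad)
    then show "sq_int M (\<lambda>x. g x $ i - h x $ i)"
      by (rule sq_int_diff)
    fix q
    assume q: "q \<in> trig_poly a b"
    then have "q \<in> Cinf_per a b"
      using side_pos by (intro trig_poly_in_Cinf_per)
    then have "(LINT x|M. g x $ i * q x) = (LINT x|M. h x $ i * q x)"
      using assms by (auto simp: has_weak_grad_def ip_def)
    then show "(LINT x|M. (g x $ i - h x $ i) * q x) = 0"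
      using sq_int_inner[OF sq(1) sq_int_trig_poly[OF q]] sq_int_inner[OF sq(2) sq_int_trig_poly[OF q]]
      by (simp add: left_diff_distrib)
  qed
  then have "AE x in M. \<forall>i. g x $ i - h x $ i = 0"
    by (subst AE_all_countable) auto
  then show ?thesis
    by (simp add: vec_eq_iff)
qed

lemma weak_grad_grad: "f \<in> H1per a b \<Longrightarrow> has_weak_grad a b f (grad a b f)"
  using someI_ex[of "has_weak_grad a b f"] by (simp add: H1per_def grad_def)

lemma sq_int_H1per: "f \<in> H1per a b \<Longrightarrow> sq_int M f"
  by (simp add: H1per_def sq_int_L2per)

lemma sq_int_grad: "f \<in> H1per a b \<Longrightarrow> sq_int M (grad a b f)"
  by (rule sq_int_weak_grad[OF weak_grad_grad])

lemma sq_int_H1u: "v \<in> H1u a b \<Longrightarrow> sq_int M v"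
  by (rule sq_int_vecI) (simp add: H1u_def sq_int_H1per)

lemma L2per_lincomb:
  fixes f g :: "real^'d \<Rightarrow> 'e::euclidean_space"
  assumes "f \<in> L2per a b" "g \<in> L2per a b"
  shows "(\<lambda>x. s *\<^sub>R f x + t *\<^sub>R g x) \<in> L2per a b"
  using assms sq_int_add[OF sq_int_scaleR[OF sq_int_L2per[OF assms(1)], of s]
      sq_int_scaleR[OF sq_int_L2per[OF assms(2)], of t]]
  by (auto simp: L2per_def periodic_def sq_int_def)

lemma sq_int_Cinf_per:
  assumes "\<psi> \<in> Cinf_per a b"
  shows "sq_int M \<psi>" "sq_int M (pderiv i \<psi>)"
proof -
  have "Ck 0 \<psi>" "Ck (Suc 0) \<psi>"
    using assms by (auto simp: Cinf_per_def simp del: Ck.simps)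
  then show "sq_int M \<psi>" "sq_int M (pderiv i \<psi>)"
    by (auto intro!: sq_int_continuous)
qed

lemma weak_grad_lincomb:
  assumes f: "f \<in> L2per a b" "has_weak_grad a b f F" and g: "g \<in> L2per a b" "has_weak_grad a b g G"
  shows "has_weak_grad a b (\<lambda>x. s * f x + t * g x) (\<lambda>x. s *\<^sub>R F x + t *\<^sub>R G x)"
  unfolding has_weak_grad_def
proof (intro conjI ballI allI)
  show "(\<lambda>x. s *\<^sub>R F x + t *\<^sub>R G x) \<in> L2per a b"
    using f g by (intro L2per_lincomb) (auto simp: has_weak_grad_def)
  fix \<psi> i
  assume \<psi>: "\<psi> \<in> Cinf_per a b"
  have lin: "(LINT x|M. (s * h x + t * k x) * r x) = s * (LINT x|M. h x * r x) + t * (LINT x|M. k x * r x)"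
    if "sq_int M h" "sq_int M k" "sq_int M r" for h k r :: "real^'d \<Rightarrow> real"
    using sq_int_inner[OF that(1,3)] sq_int_inner[OF that(2,3)]
    by (simp add: distrib_right mult.assoc)
  have "(LINT x|M. f x * pderiv i \<psi> x) = - (LINT x|M. F x $ i * \<psi> x)"
    "(LINT x|M. g x * pderiv i \<psi> x) = - (LINT x|M. G x $ i * \<psi> x)"
    using \<psi> f(2) g(2) by (auto simp: has_weak_grad_def ip_def)
  moreover have "sq_int M f" "sq_int M g" "sq_int M (\<lambda>x. F x $ i)" "sq_int M (\<lambda>x. G x $ i)"
    using f g by (auto intro: sq_int_L2per sq_int_vec_nth sq_int_weak_grad)
  ultimately show "ip a b (\<lambda>x. s * f x + t * g x) (pderiv i \<psi>)
      = - ip a b (\<lambda>x. (s *\<^sub>R F x + t *\<^sub>R G x) $ i) \<psi>"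
    using sq_int_Cinf_per[OF \<psi>] by (simp add: ip_def lin)
qed

text \<open>
  Since \<open>grad\<close> chooses some weak gradient, its linearity is a consequence of uniqueness and holds
  only almost everywhere.
\<close>

lemma H1per_lincomb:
  assumes "f \<in> H1per a b" "g \<in> H1per a b"
  shows "(\<lambda>x. s * f x + t * g x) \<in> H1per a b"
    and "AE x in M. grad a b (\<lambda>x. s * f x + t * g x) x = s *\<^sub>R grad a b f x + t *\<^sub>R grad a b g x"
proof -
  have L2: "f \<in> L2per a b" "g \<in> L2per a b"
    using assms by (auto simp: H1per_def)
  have wg: "has_weak_grad a b (\<lambda>x. s * f x + t * g x) (\<lambda>x. s *\<^sub>R grad a b f x + t *\<^sub>R grad a b g x)"
    using assms L2 by (intro weak_grad_lincomb weak_grad_grad)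
  then show H1: "(\<lambda>x. s * f x + t * g x) \<in> H1per a b"
    using L2per_lincomb[OF L2, of s t] by (auto simp: H1per_def)
  show "AE x in M. grad a b (\<lambda>x. s * f x + t * g x) x = s *\<^sub>R grad a b f x + t *\<^sub>R grad a b g x"
    by (rule weak_grad_unique[OF weak_grad_grad[OF H1] wg])
qed

lemma H1per_diff:
  assumes "f \<in> H1per a b" "g \<in> H1per a b"
  shows "AE x in M. grad a b (\<lambda>x. f x - g x) x = grad a b f x - grad a b g x"
  using H1per_lincomb(2)[OF assms, of 1 "-1"] by simp

lemma H1per_extrap:
  assumes "f \<in> H1per a b" "g \<in> H1per a b"
  shows "extrap f g \<in> H1per a b"
    and "AE x in M. grad a b (extrap f g) x = extrap (grad a b f) (grad a b g) x"
  using H1per_lincomb[OF assms, of 2 "-1"] by (simp_all add: extrap_def[abs_def])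

lemma H1per_bdf:
  assumes "f \<in> H1per a b" "g \<in> H1per a b" "h \<in> H1per a b"
  shows "bdf f g h \<in> H1per a b"
    and "AE x in M. grad a b (bdf f g h) x = bdf (grad a b f) (grad a b g) (grad a b h) x"
proof -
  define k where "k = (\<lambda>x. 3 * f x + (-4) * g x)"
  have k: "k \<in> H1per a b" "AE x in M. grad a b k x = 3 *\<^sub>R grad a b f x + (-4) *\<^sub>R grad a b g x"
    unfolding k_def using H1per_lincomb[OF assms(1,2)] by blast+
  have eq: "bdf f g h = (\<lambda>x. 1 * k x + 1 * h x)"
    by (simp add: bdf_def k_def fun_eq_iff)
  show "bdf f g h \<in> H1per a b"
    unfolding eq by (rule H1per_lincomb[OF k(1) assms(3)])
  show "AE x in M. grad a b (bdf f g h) x = bdf (grad a b f) (grad a b g) (grad a b h) x"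
    using H1per_lincomb(2)[OF k(1) assms(3), of 1 1] k(2) unfolding eq
    by eventually_elim (simp add: bdf_def)
qed

lemma H1u_extrap:
  assumes "v \<in> H1u a b" "w \<in> H1u a b"
  shows "extrap v w \<in> H1u a b"
    and "AE x in M. dvg a b (extrap v w) x = 2 * dvg a b v x - dvg a b w x"
proof -
  have H1: "(\<lambda>x. v x $ i) \<in> H1per a b" "(\<lambda>x. w x $ i) \<in> H1per a b" for i
    using assms by (auto simp: H1u_def)
  have eq: "(\<lambda>x. extrap v w x $ i) = extrap (\<lambda>x. v x $ i) (\<lambda>x. w x $ i)" for i
    by (simp add: extrap_def fun_eq_iff)
  show "extrap v w \<in> H1u a b"
    using H1per_extrap(1)[OF H1] by (simp add: H1u_def eq)
  have "AE x in M. \<forall>i. grad a b (\<lambda>x. extrap v w x $ i) x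
      = extrap (grad a b (\<lambda>x. v x $ i)) (grad a b (\<lambda>x. w x $ i)) x"
    using H1per_extrap(2)[OF H1] by (subst AE_all_countable) (simp add: eq)
  then show "AE x in M. dvg a b (extrap v w) x = 2 * dvg a b v x - dvg a b w x"
    by eventually_elim
       (simp add: dvg_def jac_def extrap_def sum_subtractf sum_distrib_left)
qed

section \<open>Divergence free fields and convection\<close>

text \<open>
  For smooth test functions this is the definition of the weak gradient of each component, summed up;
  other test functions are reached by density.
\<close>

lemma div_free_test:
  assumes v: "v \<in> H1u a b" and div: "AE x in M. dvg a b v x = 0" and \<psi>: "\<psi> \<in> Cinf_per a b"
  shows "(LINT x|M. (\<Sum>i\<in>UNIV. v x $ i * pderiv i \<psi> x)) = 0"
proof -
  let ?g = "\<lambda>i x. grad a b (\<lambda>y. v y $ i) x $ i"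
  have H1: "(\<lambda>x. v x $ i) \<in> H1per a b" for i
    using v by (simp add: H1u_def)
  have parts: "(LINT x|M. v x $ i * pderiv i \<psi> x) = - (LINT x|M. ?g i x * \<psi> x)" for i
    using weak_grad_grad[OF H1] \<psi> by (auto simp: has_weak_grad_def ip_def)
  have int1: "integrable M (\<lambda>x. v x $ i * pderiv i \<psi> x)" for i
    using sq_int_inner[OF sq_int_H1per[OF H1] sq_int_Cinf_per(2)[OF \<psi>]] by simp
  have int2: "integrable M (\<lambda>x. ?g i x * \<psi> x)" for i
    using sq_int_inner[OF sq_int_vec_nth[OF sq_int_grad[OF H1]] sq_int_Cinf_per(1)[OF \<psi>]] by simp
  have "(LINT x|M. (\<Sum>i\<in>UNIV. v x $ i * pderiv i \<psi> x)) = - (LINT x|M. (\<Sum>i\<in>UNIV. ?g i x * \<psi> x))"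
    using int1 int2 by (simp add: parts sum_negf)
  also have "(LINT x|M. (\<Sum>i\<in>UNIV. ?g i x * \<psi> x)) = (LINT x|M. 0)"
    using div by (intro lebesgue_on_integral_cong_AE)
      (auto simp: dvg_def jac_def sum_distrib_right[symmetric] elim: eventually_mono)
  finally show ?thesis
    by simp
qed

text \<open>
  The Helmholtz orthogonality behind the projection step, from \<open>div_free_test\<close> by approximating \<open>q\<close>
  in \<open>H\<^sup>1\<close>.
\<close>

lemma div_free_orthogonal_grad:
  assumes v: "v \<in> H1u a b" and div: "AE x in M. dvg a b v x = 0" and q: "q \<in> H1per a b"
  shows "ip a b v (grad a b q) = 0"
proof -
  obtain r where r: "\<And>n. r n \<in> trig_poly a b" "L2_tendsto M r q"
    "\<And>i. L2_tendsto M (\<lambda>n. pderiv i (r n)) (\<lambda>x. grad a b q x $ i)"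
  proof (rule trig_poly_H1_sequence[OF sq_int_H1per[OF q] weak_grad_grad[OF q]])
    fix r
    assume "\<And>n. r n \<in> trig_poly a b" "L2_tendsto M r q"
      "\<And>i. L2_tendsto M (\<lambda>n. pderiv i (r n)) (\<lambda>x. grad a b q x $ i)"
    then show thesis
      by (rule that)
  qed
  have "L2_tendsto M (\<lambda>n x. \<chi> i. pderiv i (r n) x) (grad a b q)"
    using r(3) by (intro L2_tendsto_vecI) simp
  then have "(\<lambda>n. LINT x|M. v x \<bullet> (\<chi> i. pderiv i (r n) x)) \<longlonglongrightarrow> (LINT x|M. v x \<bullet> grad a b q x)"
    by (intro L2_tendsto_inner L2_tendsto_const sq_int_H1u v)
  moreover have "(LINT x|M. v x \<bullet> (\<chi> i. pderiv i (r n) x)) = 0" for n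
    using div_free_test[OF v div trig_poly_in_Cinf_per[OF side_pos r(1)]] by (simp add: inner_vec_def)
  ultimately show ?thesis
    by (simp add: ip_def LIMSEQ_const_iff)
qed

text \<open>
  Up to an additive and a multiplicative constant this is a truncation of \<open>y \<bullet> y\<close>, since
  \<open>(y \<bullet> y) * damp c y = (1 - damp c y) / c\<close>.
\<close>

definition damp :: "real \<Rightarrow> real^'d \<Rightarrow> real" where
  "damp c y = inverse (1 + c * (y \<bullet> y))"

lemma damp_pos: "c > 0 \<Longrightarrow> 1 + c * (y \<bullet> y) > 0"
  by (simp add: add_pos_nonneg)

lemma damp_bounds:
  assumes "c > 0"
  shows "0 < damp c y" "damp c y \<le> 1" "\<bar>y $ l\<bar> * damp c y \<le> 1 + 1 / c"
proof -
  have y: "(y $ l)\<^sup>2 \<le> y \<bullet> y"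
    using power_mono[OF component_le_norm_cart[of y l], of 2] by (simp add: dot_square_norm)
  show "0 < damp c y" "damp c y \<le> 1"
    using damp_pos[OF assms, of y] assms by (auto simp: damp_def field_simps)
  have "2 * \<bar>y $ l\<bar> \<le> 1 + (y $ l)\<^sup>2"
    using sum_squares_bound[of 1 "\<bar>y $ l\<bar>"] by simp
  then have "\<bar>y $ l\<bar> \<le> 1 + y \<bullet> y"
    using y by linarith
  also have "\<dots> \<le> (1 + 1 / c) * (1 + c * (y \<bullet> y))"
    using assms by (simp add: field_simps)
  finally show "\<bar>y $ l\<bar> * damp c y \<le> 1 + 1 / c"
    using damp_pos[OF assms, of y] by (simp add: damp_def field_simps)
qed

lemma continuous_on_damp: "c > 0 \<Longrightarrow> continuous_on S (damp c)"
  unfolding damp_def[abs_def] using damp_pos by (intro continuous_intros) (auto simp: less_le)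

lemma damp_trig_poly:
  assumes "c > 0" and q: "\<And>l. q l \<in> trig_poly a b"
  shows "(\<lambda>x. damp c (\<chi> l. q l x)) \<in> Cinf_per a b"
    and "pderiv i (\<lambda>x. damp c (\<chi> l. q l x)) x
      = - (2 * c) * (damp c (\<chi> l. q l x))\<^sup>2 * (\<Sum>l\<in>UNIV. q l x * pderiv i (q l) x)"
proof -
  define S where "S x = 1 + c * (\<Sum>l\<in>UNIV. q l x * q l x)" for x
  have eq: "(\<lambda>x. damp c (\<chi> l. q l x)) = (\<lambda>x. inverse (S x))"
    by (simp add: damp_def S_def inner_vec_def fun_eq_iff)
  have S_nz: "S x \<noteq> 0" for x
    using damp_pos[OF assms(1), of "\<chi> l. q l x"] by (simp add: S_def inner_vec_def)
  have sum: "(\<lambda>x. \<Sum>l\<in>I. q l x * q l x) \<in> trig_poly a b" for I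
    by (induction I rule: infinite_finite_induct) (simp_all add: lspan.zero lspan_add trig_poly_mult q)
  have S: "S \<in> trig_poly a b"
    unfolding S_def[abs_def] by (intro lspan_add trig_poly_const lspan_scale sum)
  have "periodic a b S"
    using periodic_trig_poly[OF side_pos S] .
  then show "(\<lambda>x. damp c (\<chi> l. q l x)) \<in> Cinf_per a b"
    unfolding eq using Ck_inverse[OF S_nz Ck_trig_poly[OF S]] by (simp add: Cinf_per_def periodic_def)
  have dsum: "pderiv i (\<lambda>x. \<Sum>l\<in>I. q l x * q l x) x = 2 * (\<Sum>l\<in>I. q l x * pderiv i (q l) x)" for I
  proof (induction I rule: infinite_finite_induct)
    case (insert l I)
    then show ?case
      using differentiable_trig_poly[OF trig_poly_mult[OF q q], of l l x]
        differentiable_trig_poly[OF sum, of I x] differentiable_trig_poly[OF q, of l x]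
      by (simp add: pderiv_add pderiv_mult distrib_left)
  qed auto
  have "pderiv i S x = 2 * c * (\<Sum>l\<in>UNIV. q l x * pderiv i (q l) x)"
    unfolding S_def[abs_def]
    using differentiable_trig_poly[OF trig_poly_const, of 1 x]
      differentiable_trig_poly[OF sum, of UNIV x] differentiable_trig_poly[OF lspan_scale[OF sum], of c UNIV x]
    by (simp add: pderiv_add pderiv_cmult dsum del: sum_distrib_left)
  then show "pderiv i (\<lambda>x. damp c (\<chi> l. q l x)) x
      = - (2 * c) * (damp c (\<chi> l. q l x))\<^sup>2 * (\<Sum>l\<in>UNIV. q l x * pderiv i (q l) x)"
    using fun_cong[OF eq, of x] unfolding eq
    by (simp add: pderiv_inverse[OF differentiable_trig_poly[OF S] S_nz] power2_eq_square)
qed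

text \<open>
  With \<open>\<psi> = damp c w\<close> the chain rule gives
  \<open>v \<bullet> grad \<psi> = - 2 * c * (damp c w)\<^sup>2 * ((jac w *v v) \<bullet> w)\<close>. It is applied to trigonometric
  approximants of \<open>w\<close>, for which \<open>\<psi>\<close> is smooth. In the limit the derivatives of the approximants
  converge in mean square, and so do the coefficients \<open>v $ i * w $ l * (damp c w)\<^sup>2\<close>: they converge almost
  everywhere along a subsequence and are dominated by a multiple of \<open>v $ i\<close>.
\<close>

lemma damped_convection_zero:
  assumes v: "v \<in> H1u a b" and div: "AE x in M. dvg a b v x = 0" and w: "w \<in> H1u a b"
    and c: "c > 0"
  shows "(LINT x|M. (damp c (w x))\<^sup>2 * ((jac a b w x *v v x) \<bullet> w x)) = 0"
proof -
  have wH1: "(\<lambda>x. w x $ l) \<in> H1per a b" for l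
    using w by (simp add: H1u_def)
  have vsq: "sq_int M (\<lambda>x. v x $ i)" for i
    by (rule sq_int_vec_nth[OF sq_int_H1u[OF v]])
  have "\<exists>q. \<forall>l. (\<forall>n. q l n \<in> trig_poly a b) \<and> L2_tendsto M (q l) (\<lambda>x. w x $ l) \<and>
      (\<forall>i. L2_tendsto M (\<lambda>n. pderiv i (q l n)) (\<lambda>x. grad a b (\<lambda>y. w y $ l) x $ i))"
  proof (intro choice allI)
    fix l
    show "\<exists>q. (\<forall>n. q n \<in> trig_poly a b) \<and> L2_tendsto M q (\<lambda>x. w x $ l) \<and>
      (\<forall>i. L2_tendsto M (\<lambda>n. pderiv i (q n)) (\<lambda>x. grad a b (\<lambda>y. w y $ l) x $ i))"
      by (rule trig_poly_H1_sequence[OF sq_int_H1per[OF wH1] weak_grad_grad[OF wH1], of l]) blast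
  qed
  then obtain q where q: "\<And>l n. q l n \<in> trig_poly a b" "\<And>l. L2_tendsto M (q l) (\<lambda>x. w x $ l)"
    "\<And>l i. L2_tendsto M (\<lambda>n. pderiv i (q l n)) (\<lambda>x. grad a b (\<lambda>y. w y $ l) x $ i)"
    by blast
  define Q where "Q n x = (\<chi> l. q l n x)" for n x
  have Q: "L2_tendsto M Q w"
    using q(2) by (intro L2_tendsto_vecI) (simp add: Q_def)
  from Q obtain r where r: "strict_mono r" and lim: "AE x in M. (\<lambda>n. Q (r n) x) \<longlonglongrightarrow> w x"
    by (rule L2_tendsto_AE_subseq)
  have Qsq: "sq_int M (Q n)" "sq_int M w" for n
    using Q by (auto simp: L2_tendsto_def)
  let ?d = "\<lambda>l i. L2_tendsto M (\<lambda>n. pderiv i (q l (r n))) (\<lambda>x. grad a b (\<lambda>y. w y $ l) x $ i)"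
  have dq: "?d l i" for l i
    using L2_tendsto_subseq[OF q(3) r] .
  have damp_meas: "(\<lambda>x. damp c (f x)) \<in> borel_measurable M" if "f \<in> borel_measurable M" for f
    using continuous_on_damp[OF c, of UNIV] that
    by (rule borel_measurable_continuous_on)
  have coeff: "L2_tendsto M (\<lambda>n x. v x $ i * Q (r n) x $ l * (damp c (Q (r n) x))\<^sup>2)
      (\<lambda>x. v x $ i * w x $ l * (damp c (w x))\<^sup>2)" for i l
  proof (rule L2_tendsto_dominated[where g = "\<lambda>x. (1 + 1 / c) * v x $ i"])
    have meas: "(\<lambda>x. v x $ i * f x $ l * (damp c (f x))\<^sup>2) \<in> borel_measurable M" if "sq_int M f" for f
      using vsq[of i] sq_int_vec_nth[OF that, of l] that
      by (intro borel_measurable_times borel_measurable_power damp_meas) (auto simp: sq_int_def)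
    then show "(\<lambda>x. v x $ i * Q (r n) x $ l * (damp c (Q (r n) x))\<^sup>2) \<in> borel_measurable M"
      "(\<lambda>x. v x $ i * w x $ l * (damp c (w x))\<^sup>2) \<in> borel_measurable M" for n
      using Qsq by blast+
    show "sq_int M (\<lambda>x. (1 + 1 / c) * v x $ i)"
      by (rule sq_int_mult[OF vsq])
    have "norm (v x $ i * y $ l * (damp c y)\<^sup>2) \<le> norm ((1 + 1 / c) * v x $ i)" for x y
    proof -
      have "\<bar>y $ l\<bar> * damp c y * damp c y \<le> (1 + 1 / c) * 1"
        using damp_bounds[OF c, of y] c by (intro mult_mono) (auto simp: less_imp_le)
      then have "\<bar>v x $ i\<bar> * (\<bar>y $ l\<bar> * damp c y * damp c y) \<le> \<bar>v x $ i\<bar> * (1 + 1 / c)"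
        by (intro mult_left_mono) auto
      then show ?thesis
        using c damp_bounds(1)[OF c, of y] by (simp add: abs_mult power2_eq_square mult_ac)
    qed
    then show "AE x in M. norm (v x $ i * Q (r n) x $ l * (damp c (Q (r n) x))\<^sup>2)
        \<le> norm ((1 + 1 / c) * v x $ i)" for n
      by blast
    show "AE x in M. (\<lambda>n. v x $ i * Q (r n) x $ l * (damp c (Q (r n) x))\<^sup>2)
        \<longlonglongrightarrow> v x $ i * w x $ l * (damp c (w x))\<^sup>2"
      using lim
    proof eventually_elim
      case (elim x)
      have "(\<lambda>n. damp c (Q (r n) x)) \<longlonglongrightarrow> damp c (w x)"
        using continuous_on_tendsto_compose[OF continuous_on_damp[OF c, of UNIV] elim] by simp
      then show ?case
        using elim by (intro tendsto_intros)
    qed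
  qed
  have int: "integrable M (\<lambda>x. v x $ i * Q (r n) x $ l * (damp c (Q (r n) x))\<^sup>2 * pderiv i (q l (r n)) x)"
    "integrable M (\<lambda>x. v x $ i * w x $ l * (damp c (w x))\<^sup>2 * grad a b (\<lambda>y. w y $ l) x $ i)" for n i l
    using sq_int_inner[of M "\<lambda>x. v x $ i * Q (r n) x $ l * (damp c (Q (r n) x))\<^sup>2" "pderiv i (q l (r n))"]
      sq_int_inner[of M "\<lambda>x. v x $ i * w x $ l * (damp c (w x))\<^sup>2" "\<lambda>x. grad a b (\<lambda>y. w y $ l) x $ i"]
      coeff[of i l] dq[of i l] by (auto simp: L2_tendsto_def)
  have zero: "(\<Sum>i\<in>UNIV. \<Sum>l\<in>UNIV. LINT x|M. v x $ i * Q (r n) x $ l * (damp c (Q (r n) x))\<^sup>2 * pderiv i (q l (r n)) x) = 0" for n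
  proof -
    let ?\<psi> = "\<lambda>x. damp c (\<chi> l. q l (r n) x)"
    have "(\<Sum>i\<in>UNIV. v x $ i * pderiv i ?\<psi> x)
        = - (2 * c) * (\<Sum>i\<in>UNIV. \<Sum>l\<in>UNIV. v x $ i * Q (r n) x $ l * (damp c (Q (r n) x))\<^sup>2 * pderiv i (q l (r n)) x)" for x
      unfolding damp_trig_poly(2)[OF c q(1)] by (simp add: Q_def sum_distrib_left sum_negf mult_ac)
    then have "(LINT x|M. - (2 * c) * (\<Sum>i\<in>UNIV. \<Sum>l\<in>UNIV. v x $ i * Q (r n) x $ l * (damp c (Q (r n) x))\<^sup>2 * pderiv i (q l (r n)) x)) = 0"
      using div_free_test[OF v div damp_trig_poly(1)[OF c, of "\<lambda>l. q l (r n)", OF q(1)]] by simp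
    then show ?thesis
      using c int by simp
  qed
  have "(\<lambda>n. \<Sum>i\<in>UNIV. \<Sum>l\<in>UNIV. LINT x|M. v x $ i * Q (r n) x $ l * (damp c (Q (r n) x))\<^sup>2 * pderiv i (q l (r n)) x)
      \<longlonglongrightarrow> (\<Sum>i\<in>UNIV. \<Sum>l\<in>UNIV. LINT x|M. v x $ i * w x $ l * (damp c (w x))\<^sup>2 * grad a b (\<lambda>y. w y $ l) x $ i)"
    using L2_tendsto_inner[OF coeff dq] by (intro tendsto_sum) simp
  then have "(\<Sum>i\<in>UNIV. \<Sum>l\<in>UNIV. LINT x|M. v x $ i * w x $ l * (damp c (w x))\<^sup>2 * grad a b (\<lambda>y. w y $ l) x $ i) = 0"
    unfolding zero by (simp add: LIMSEQ_const_iff)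
  then have "(LINT x|M. (\<Sum>i\<in>UNIV. \<Sum>l\<in>UNIV. v x $ i * w x $ l * (damp c (w x))\<^sup>2 * grad a b (\<lambda>y. w y $ l) x $ i)) = 0"
    using int by simp
  also have "(\<lambda>x. \<Sum>i\<in>UNIV. \<Sum>l\<in>UNIV. v x $ i * w x $ l * (damp c (w x))\<^sup>2 * grad a b (\<lambda>y. w y $ l) x $ i)
      = (\<lambda>x. (damp c (w x))\<^sup>2 * ((jac a b w x *v v x) \<bullet> w x))"
    by (subst sum.swap)
       (simp add: fun_eq_iff inner_vec_def matrix_vector_mult_def jac_def sum_distrib_left sum_distrib_right mult_ac)
  finally show ?thesis .
qed

text \<open>
  If the integrand is not integrable, its integral is 0 by convention; otherwise it dominates the
  damped integrands, whose damping factor tends to 1 as \<open>c\<close> tends to 0.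
\<close>

lemma convection_skew:
  assumes v: "v \<in> H1u a b" and div: "AE x in M. dvg a b v x = 0" and w: "w \<in> H1u a b"
  shows "ip a b (convB a b v w) w = 0"
proof -
  let ?g = "\<lambda>x. (jac a b w x *v v x) \<bullet> w x"
  have "ip a b (convB a b v w) w = (LINT x|M. ?g x)"
    unfolding ip_def using div
    by (intro lebesgue_on_integral_cong_AE) (auto simp: convB_def elim: eventually_mono)
  also have "\<dots> = 0"
  proof (cases "integrable M ?g")
    case False
    then show ?thesis
      by (rule not_integrable_integral_eq)
  next
    case True
    define c where "c n = inverse (real (Suc n))" for n
    have c: "c n > 0" for n
      by (simp add: c_def)
    have w_meas: "w \<in> borel_measurable M"
      using sq_int_H1u[OF w] by (simp add: sq_int_def)
    have "(\<lambda>n. LINT x|M. (damp (c n) (w x))\<^sup>2 * ?g x) \<longlonglongrightarrow> (LINT x|M. ?g x)"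
    proof (rule integral_dominated_convergence)
      show "integrable M (\<lambda>x. norm (?g x))" "?g \<in> borel_measurable M"
        using True by auto
      have "(\<lambda>x. damp (c n) (w x)) \<in> borel_measurable M" for n
        using continuous_on_damp[OF c, of UNIV] w_meas by (rule borel_measurable_continuous_on)
      then show "(\<lambda>x. (damp (c n) (w x))\<^sup>2 * ?g x) \<in> borel_measurable M" for n
        using True by (intro borel_measurable_times borel_measurable_power) auto
      show "AE x in M. norm ((damp (c n) (w x))\<^sup>2 * ?g x) \<le> norm (?g x)" for n
        using damp_bounds(1,2)[OF c]
        by (intro AE_I2) (simp add: abs_mult mult_left_le_one_le power_le_one less_imp_le)
      have "(\<lambda>n. damp (c n) (w x)) \<longlonglongrightarrow> inverse (1 + 0 * (w x \<bullet> w x))" for x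
        unfolding damp_def c_def by (intro tendsto_intros LIMSEQ_inverse_real_of_nat) simp
      then have "(\<lambda>n. (damp (c n) (w x))\<^sup>2 * ?g x) \<longlonglongrightarrow> 1\<^sup>2 * ?g x" for x
        by (intro tendsto_intros) simp
      then show "AE x in M. (\<lambda>n. (damp (c n) (w x))\<^sup>2 * ?g x) \<longlonglongrightarrow> ?g x"
        by simp
    qed
    then show ?thesis
      unfolding damped_convection_zero[OF v div w c] by (simp add: LIMSEQ_const_iff)
  qed
  finally show ?thesis .
qed

section \<open>Energy identities\<close>

lemma ip_scaleR: "ip a b (\<lambda>x. c *\<^sub>R f x) g = c * ip a b f g"
  by (simp add: ip_def)

lemma ip_cong_AE:
  assumes "AE x in M. f x \<bullet> g x = h x \<bullet> k x"
  shows "ip a b f g = ip a b h k"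
  unfolding ip_def using assms by (intro lebesgue_on_integral_cong_AE) auto

lemma sq_int_bdf: "sq_int M f \<Longrightarrow> sq_int M g \<Longrightarrow> sq_int M h \<Longrightarrow> sq_int M (bdf f g h)"
  unfolding bdf_def[abs_def] by (intro sq_int_add sq_int_diff sq_int_scaleR)

lemma sq_int_extrap: "sq_int M f \<Longrightarrow> sq_int M g \<Longrightarrow> sq_int M (extrap f g)"
  unfolding extrap_def[abs_def] by (intro sq_int_diff sq_int_scaleR)

text \<open>
  The G-stability of the second order backward difference formula: \<open>bdf f g h \<bullet> f\<close> is the
  difference of the two energy densities plus half the square of the second difference \<open>r\<close>.
\<close>

lemma avg_sq_diff_le:
  fixes f g h :: "real^'d \<Rightarrow> 'e::euclidean_space"
  assumes "sq_int M f" "sq_int M g" "sq_int M h"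
  shows "avg_sq a b f g - avg_sq a b g h \<le> ip a b (bdf f g h) f"
proof -
  define r where "r x = f x - 2 *\<^sub>R g x + h x" for x
  have sq: "sq_int M r" "sq_int M (extrap f g)" "sq_int M (extrap g h)" "sq_int M (bdf f g h)"
    using assms unfolding r_def[abs_def]
    by (auto intro!: sq_int_extrap sq_int_bdf sq_int_add sq_int_diff sq_int_scaleR)
  have "bdf f g h x \<bullet> f x = (1/2) * (f x \<bullet> f x) + (1/2) * (extrap f g x \<bullet> extrap f g x)
      - (1/2) * (g x \<bullet> g x) - (1/2) * (extrap g h x \<bullet> extrap g h x) + (1/2) * (r x \<bullet> r x)" for x
    by (simp add: bdf_def extrap_def r_def inner_add_left inner_add_right inner_diff_left
        inner_diff_right inner_commute algebra_simps)
  then have "ip a b (bdf f g h) f = avg_sq a b f g - avg_sq a b g h + (1/2) * (LINT x|M. r x \<bullet> r x)"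
    using assms sq by (simp add: ip_def avg_sq_def nsq_def sq_int_square)
  moreover have "0 \<le> (LINT x|M. r x \<bullet> r x)"
    by (intro Bochner_Integration.integral_nonneg) simp
  ultimately show ?thesis
    by simp
qed

text \<open>
  By the projection step \<open>ut\<close> is \<open>u2\<close> plus \<open>c = 2 * \<delta>t / 3\<close> times the gradient of the pressure
  increment. All pairings of velocities with pressure gradients vanish, and \<open>c\<close> is such that the
  quadratic terms in the pressure gradients add up to the difference of their squared norms and the
  squared norm of the increment, both with the factor \<open>\<delta>t / 3\<close>.
\<close>

lemma pressure_correction_energy:
  assumes u: "u2 \<in> H1u a b" "u1 \<in> H1u a b" "u0 \<in> H1u a b"
    and div: "AE x in M. dvg a b u2 x = 0" "AE x in M. dvg a b u1 x = 0" "AE x in M. dvg a b u0 x = 0"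
    and p: "p1 \<in> H1per a b" "p2 \<in> H1per a b" and dt: "\<delta>t > 0"
    and proj: "AE x in M. (3 / (2 * \<delta>t)) *\<^sub>R (u2 x - ut x) + grad a b (\<lambda>y. p2 y - p1 y) x = 0"
  shows "1 / (2 * \<delta>t) * ip a b (bdf u2 u1 u0) u2
      + \<delta>t / 3 * (nsq a b (grad a b p2) - nsq a b (grad a b p1))
    \<le> 1 / (2 * \<delta>t) * ip a b (bdf ut u1 u0) ut + ip a b (grad a b p1) ut"
proof -
  define c where "c = 2 * \<delta>t / 3"
  define G1 G2 where "G1 = grad a b p1" and "G2 = grad a b p2"
  define w where "w x = u2 x + c *\<^sub>R (G2 x - G1 x)" for x
  have ut: "AE x in M. ut x = w x"
    using proj H1per_diff[OF p(2,1)]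
  proof eventually_elim
    case (elim x)
    then have "c *\<^sub>R ((3 / (2 * \<delta>t)) *\<^sub>R (u2 x - ut x) + (G2 x - G1 x)) = 0"
      by (simp add: G1_def G2_def)
    then have "(u2 x - ut x) + c *\<^sub>R (G2 x - G1 x) = 0"
      using dt by (simp add: c_def scaleR_add_right)
    then show ?case
      by (simp add: w_def algebra_simps)
  qed
  have sq: "sq_int M u2" "sq_int M u1" "sq_int M u0" "sq_int M G1" "sq_int M G2"
    using u p by (auto simp: G1_def G2_def intro: sq_int_H1u sq_int_grad)
  have orth: "(LINT x|M. v x \<bullet> G1 x) = 0" "(LINT x|M. v x \<bullet> G2 x) = 0"
    if "v \<in> H1u a b" "AE x in M. dvg a b v x = 0" for v
    using div_free_orthogonal_grad[OF that p(1)] div_free_orthogonal_grad[OF that p(2)]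
    by (simp_all add: ip_def G1_def G2_def)
  let ?g11 = "LINT x|M. G1 x \<bullet> G1 x" and ?g12 = "LINT x|M. G1 x \<bullet> G2 x" and ?g22 = "LINT x|M. G2 x \<bullet> G2 x"
  have int: "integrable M (\<lambda>x. v x \<bullet> w x)" if "sq_int M v" "sq_int M w" for v w :: "real^'d \<Rightarrow> real^'d"
    using that by (rule sq_int_inner)
  have "bdf w u1 u0 x \<bullet> w x = bdf u2 u1 u0 x \<bullet> u2 x
      + (c * 6) * (u2 x \<bullet> G2 x) - (c * 6) * (u2 x \<bullet> G1 x) - (c * 4) * (u1 x \<bullet> G2 x)
      + (c * 4) * (u1 x \<bullet> G1 x) + c * (u0 x \<bullet> G2 x) - c * (u0 x \<bullet> G1 x)
      + (3 * c\<^sup>2) * (G2 x \<bullet> G2 x) - (6 * c\<^sup>2) * (G1 x \<bullet> G2 x) + (3 * c\<^sup>2) * (G1 x \<bullet> G1 x)" for x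
    by (simp add: bdf_def w_def inner_add_left inner_add_right inner_diff_left
        inner_diff_right inner_commute power2_eq_square algebra_simps)
  moreover have "integrable M (\<lambda>x. bdf u2 u1 u0 x \<bullet> u2 x)"
    using sq by (intro int sq_int_bdf)
  ultimately have "ip a b (bdf w u1 u0) w
      = ip a b (bdf u2 u1 u0) u2 + 3 * c\<^sup>2 * ?g22 - 6 * c\<^sup>2 * ?g12 + 3 * c\<^sup>2 * ?g11"
    using int sq orth[OF u(1) div(1)] orth[OF u(2) div(2)] orth[OF u(3) div(3)]
    by (simp add: ip_def)
  moreover have "ip a b (bdf ut u1 u0) ut = ip a b (bdf w u1 u0) w"
    using ut by (intro ip_cong_AE) (auto simp: bdf_def elim: eventually_mono)
  moreover have "ip a b G1 ut = c * ?g12 - c * ?g11"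
  proof -
    have "ip a b G1 ut = ip a b G1 w"
      using ut by (intro ip_cong_AE) (auto elim: eventually_mono)
    also have "G1 x \<bullet> w x = u2 x \<bullet> G1 x + c * (G1 x \<bullet> G2 x) - c * (G1 x \<bullet> G1 x)" for x
      by (simp add: w_def inner_add_right inner_diff_right inner_commute algebra_simps)
    then have "ip a b G1 w = c * ?g12 - c * ?g11"
      using int sq orth[OF u(1) div(1)] by (simp add: ip_def)
    finally show ?thesis .
  qed
  moreover have "0 \<le> ?g22 - 2 * ?g12 + ?g11"
  proof -
    have "0 \<le> (LINT x|M. (G2 x - G1 x) \<bullet> (G2 x - G1 x))"
      by (intro Bochner_Integration.integral_nonneg) simp
    also have "(G2 x - G1 x) \<bullet> (G2 x - G1 x) = G2 x \<bullet> G2 x - 2 * (G1 x \<bullet> G2 x) + G1 x \<bullet> G1 x" for x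
      by (simp add: inner_diff_left inner_diff_right inner_commute)
    then have "(LINT x|M. (G2 x - G1 x) \<bullet> (G2 x - G1 x)) = ?g22 - 2 * ?g12 + ?g11"
      using int sq by simp
    finally show ?thesis .
  qed
  then have "0 \<le> \<delta>t / 3 * (?g22 - 2 * ?g12 + ?g11)"
    using dt by simp
  moreover have "1 / (2 * \<delta>t) * (I + 3 * c\<^sup>2 * ?g22 - 6 * c\<^sup>2 * ?g12 + 3 * c\<^sup>2 * ?g11) + (c * ?g12 - c * ?g11)
      = 1 / (2 * \<delta>t) * I + \<delta>t / 3 * (?g22 - ?g11) + \<delta>t / 3 * (?g22 - 2 * ?g12 + ?g11)" for I
    using dt by (simp add: c_def power2_eq_square field_simps)
  ultimately show ?thesis
    by (simp add: nsq_def ip_def G1_def[symmetric] G2_def[symmetric])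
qed

text \<open>
  The transport term is written in the form in which it occurs in the momentum equation; both have the
  same integrand.
\<close>

lemma transport_tested:
  assumes "transport_eq a b m \<delta>t ut fs f2 f1 f0 \<mu>" "\<mu> \<in> H1per a b"
  shows "1 / (2 * \<delta>t) * ip a b \<mu> (bdf f2 f1 f0) + m * nsq a b (grad a b \<mu>)
    = ip a b (\<lambda>x. fs x *\<^sub>R grad a b \<mu> x) ut"
proof -
  have "ip a b (\<lambda>x. bdf f2 f1 f0 x / (2 * \<delta>t)) \<mu> = 1 / (2 * \<delta>t) * ip a b \<mu> (bdf f2 f1 f0)"
    by (simp add: ip_def mult.commute)
  moreover have "ip a b (\<lambda>x. fs x *\<^sub>R ut x) (grad a b \<mu>) = ip a b (\<lambda>x. fs x *\<^sub>R grad a b \<mu> x) ut"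
    by (simp add: ip_def inner_commute)
  ultimately show ?thesis
    using assms unfolding transport_eq_def nsq_def by (auto dest!: bspec)
qed

text \<open>
  The updates of the auxiliary variables are designed so that the nonlinear terms, tested with the time
  differences, become pairings of each auxiliary variable with its own time difference. The two terms
  with the time difference of the density that involve \<open>V2\<close>, one from each chemical potential,
  cancel and leave \<open>bdf V2 V1 V0\<close>.
\<close>

lemma chemical_potentials_tested:
  fixes \<phi>2 \<phi>1 \<phi>0 \<rho>2 \<rho>1 \<rho>0 U2 U1 U0 V2 V1 V0 W2 W1 W0 :: "real^'d \<Rightarrow> real"
  assumes mu: "mu_phi_eq a b \<epsilon> \<alpha> \<phi>s Zs \<mu>\<phi> \<phi>2 U2 V2" "mu_rho_eq a b \<eta> \<alpha> \<beta> Hs \<mu>\<rho> \<rho>2 V2 W2"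
    and \<phi>: "\<phi>2 \<in> H1per a b" "\<phi>1 \<in> H1per a b" "\<phi>0 \<in> H1per a b"
    and \<rho>: "\<rho>2 \<in> H1per a b" "\<rho>1 \<in> H1per a b" "\<rho>0 \<in> H1per a b"
    and V: "sq_int M V2" "sq_int M V1" "sq_int M V0"
    and U_eq: "AE x in M. bdf U2 U1 U0 x = 2 * \<phi>s x * bdf \<phi>2 \<phi>1 \<phi>0 x"
    and V_eq: "AE x in M. bdf V2 V1 V0 x = bdf \<rho>2 \<rho>1 \<rho>0 x - Zs x \<bullet> grad a b (bdf \<phi>2 \<phi>1 \<phi>0) x"
    and W_eq: "AE x in M. bdf W2 W1 W0 x = 1/2 * Hs x * bdf \<rho>2 \<rho>1 \<rho>0 x"
  shows "ip a b \<mu>\<phi> (bdf \<phi>2 \<phi>1 \<phi>0) + ip a b \<mu>\<rho> (bdf \<rho>2 \<rho>1 \<rho>0)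
    = \<epsilon> * ip a b (bdf (grad a b \<phi>2) (grad a b \<phi>1) (grad a b \<phi>0)) (grad a b \<phi>2)
    + \<eta> * ip a b (bdf (grad a b \<rho>2) (grad a b \<rho>1) (grad a b \<rho>0)) (grad a b \<rho>2)
    + 1 / (2 * \<epsilon>) * ip a b (bdf U2 U1 U0) U2 + \<alpha> * ip a b (bdf V2 V1 V0) V2
    + 2 * \<beta> * ip a b (bdf W2 W1 W0) W2"
proof -
  let ?d\<phi> = "bdf \<phi>2 \<phi>1 \<phi>0" and ?d\<rho> = "bdf \<rho>2 \<rho>1 \<rho>0"
  have grad: "ip a b (grad a b f2) (grad a b (bdf f2 f1 f0))
      = ip a b (bdf (grad a b f2) (grad a b f1) (grad a b f0)) (grad a b f2)"
    if "f2 \<in> H1per a b" "f1 \<in> H1per a b" "f0 \<in> H1per a b" for f2 f1 f0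
    using H1per_bdf(2)[OF that]
    by (intro ip_cong_AE) (auto simp: inner_commute elim: eventually_mono)
  have U: "ip a b (\<lambda>x. \<phi>s x * U2 x) ?d\<phi> = 1 / 2 * ip a b (bdf U2 U1 U0) U2"
    unfolding ip_scaleR[symmetric] using U_eq by (intro ip_cong_AE) (auto elim!: eventually_mono)
  have W: "ip a b (\<lambda>x. Hs x * W2 x) ?d\<rho> = 2 * ip a b (bdf W2 W1 W0) W2"
    unfolding ip_scaleR[symmetric] using W_eq by (intro ip_cong_AE) (auto elim!: eventually_mono)
  have "sq_int M ?d\<rho>"
    using H1per_bdf(1)[OF \<rho>] by (rule sq_int_H1per)
  then have int: "integrable M (\<lambda>x. V2 x * ?d\<rho> x)" "integrable M (\<lambda>x. V2 x * bdf V2 V1 V0 x)"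
    using sq_int_inner[OF V(1)] sq_int_bdf[OF V] by fastforce+
  have "ip a b (\<lambda>x. V2 x *\<^sub>R Zs x) (grad a b ?d\<phi>) = (LINT x|M. V2 x * ?d\<rho> x - V2 x * bdf V2 V1 V0 x)"
    unfolding ip_def
  proof (rule lebesgue_on_integral_cong_AE)
    show "AE x in M. (V2 x *\<^sub>R Zs x) \<bullet> grad a b ?d\<phi> x = V2 x * ?d\<rho> x - V2 x * bdf V2 V1 V0 x"
      using V_eq by eventually_elim (simp add: right_diff_distrib)
  qed simp
  then have Z: "ip a b (\<lambda>x. V2 x *\<^sub>R Zs x) (grad a b ?d\<phi>) = ip a b V2 ?d\<rho> - ip a b (bdf V2 V1 V0) V2"
    using int by (simp add: ip_def mult.commute)
  have "ip a b \<mu>\<phi> ?d\<phi> = \<epsilon> * ip a b (grad a b \<phi>2) (grad a b ?d\<phi>)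
      + 1 / \<epsilon> * ip a b (\<lambda>x. \<phi>s x * U2 x) ?d\<phi> - \<alpha> * ip a b (\<lambda>x. V2 x *\<^sub>R Zs x) (grad a b ?d\<phi>)"
    using mu(1) H1per_bdf(1)[OF \<phi>] unfolding mu_phi_eq_def by blast
  moreover have "ip a b \<mu>\<rho> ?d\<rho> = \<eta> * ip a b (grad a b \<rho>2) (grad a b ?d\<rho>)
      + \<alpha> * ip a b V2 ?d\<rho> + \<beta> * ip a b (\<lambda>x. Hs x * W2 x) ?d\<rho>"
    using mu(2) H1per_bdf(1)[OF \<rho>] unfolding mu_rho_eq_def by blast
  ultimately show ?thesis
    unfolding grad[OF \<phi>] grad[OF \<rho>] U W Z by (simp add: algebra_simps)
qed

end

theorem theorem3p2:
  fixes a b :: "real^'d"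
    and \<nu> M1 M2 \<epsilon> \<eta> \<alpha> \<beta> \<epsilon>h A \<delta>t :: real
    and n :: nat
    and u :: "nat \<Rightarrow> real^'d \<Rightarrow> real^'d"
    and p \<phi> \<rho> U V W :: "nat \<Rightarrow> real^'d \<Rightarrow> real"
    and ut :: "real^'d \<Rightarrow> real^'d"
    and \<mu>\<phi> \<mu>\<rho> :: "real^'d \<Rightarrow> real"
  assumes dim: "CARD('d) = 2 \<or> CARD('d) = 3"
    and box: "\<forall>i. a $ i < b $ i"
    and params: "\<nu> > 0" "M1 > 0" "M2 > 0" "\<epsilon> > 0" "\<eta> > 0" "\<alpha> > 0" "\<beta> > 0"
    and eh: "0 < \<epsilon>h" "\<epsilon>h < 1/2"
    and A: "A > 0" "\<forall>r. FH \<epsilon>h r + A > 0"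
    and dt: "\<delta>t > 0"
    and n: "n \<ge> 1"
    and H1: "\<forall>k\<in>{n - 1, n, n + 1}. u k \<in> H1u a b \<and> \<phi> k \<in> H1per a b \<and> \<rho> k \<in> H1per a b"
    and L2: "\<forall>k\<in>{n - 1, n, n + 1}. U k \<in> L2per a b \<and> V k \<in> L2per a b \<and> W k \<in> L2per a b"
    and pres: "p n \<in> H1per a b" "p (n + 1) \<in> H1per a b"
    and new: "ut \<in> H1u a b" "\<mu>\<phi> \<in> H1per a b" "\<mu>\<rho> \<in> H1per a b"
    and div_free: "AE x in lebesgue_on (box a b). dvg a b (u (n - 1)) x = 0"
      "AE x in lebesgue_on (box a b). dvg a b (u n) x = 0"
    and step1: "bdf2_step1 a b \<nu> M1 M2 \<epsilon> \<eta> \<alpha> \<beta> \<epsilon>h A \<delta>t n u p \<phi> \<rho> U V W ut \<mu>\<phi> \<mu>\<rho>"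
    and step2: "bdf2_step2 a b \<delta>t n u p ut"
  shows "1 / \<delta>t * (E2nd a b \<epsilon> \<eta> \<alpha> \<beta> \<delta>t u p \<phi> \<rho> U V W (n + 1) n
                 - E2nd a b \<epsilon> \<eta> \<alpha> \<beta> \<delta>t u p \<phi> \<rho> U V W n (n - 1))
         \<le> - \<nu> * nsq a b (jac a b ut) - M1 * nsq a b (grad a b \<mu>\<phi>) - M2 * nsq a b (grad a b \<mu>\<rho>)"
proof -
  interpret periodic_box a b
    using box by unfold_locales simp
  let ?M = "lebesgue_on (box a b)"
  define \<phi>s \<rho>s us where "\<phi>s = extrap (\<phi> n) (\<phi> (n - 1))" and "\<rho>s = extrap (\<rho> n) (\<rho> (n - 1))"
    and "us = extrap (u n) (u (n - 1))"
  have u: "u (n + 1) \<in> H1u a b" "u n \<in> H1u a b" "u (n - 1) \<in> H1u a b"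
    and \<phi>: "\<phi> (n + 1) \<in> H1per a b" "\<phi> n \<in> H1per a b" "\<phi> (n - 1) \<in> H1per a b"
    and \<rho>: "\<rho> (n + 1) \<in> H1per a b" "\<rho> n \<in> H1per a b" "\<rho> (n - 1) \<in> H1per a b"
    using H1 by auto
  have U: "sq_int ?M (U (n + 1))" "sq_int ?M (U n)" "sq_int ?M (U (n - 1))"
    and V: "sq_int ?M (V (n + 1))" "sq_int ?M (V n)" "sq_int ?M (V (n - 1))"
    and W: "sq_int ?M (W (n + 1))" "sq_int ?M (W n)" "sq_int ?M (W (n - 1))"
    using L2 by (auto intro: sq_int_L2per)
  note step1' = step1[unfolded bdf2_step1_def Let_def, folded \<phi>s_def \<rho>s_def us_def]
  have mom: "momentum_eq a b \<nu> \<delta>t us \<phi>s \<rho>s ut (u n) (u (n - 1)) (p n) \<mu>\<phi> \<mu>\<rho>"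
    and tr: "transport_eq a b M1 \<delta>t ut \<phi>s (\<phi> (n + 1)) (\<phi> n) (\<phi> (n - 1)) \<mu>\<phi>"
      "transport_eq a b M2 \<delta>t ut \<rho>s (\<rho> (n + 1)) (\<rho> n) (\<rho> (n - 1)) \<mu>\<rho>"
    using step1' by auto
  have us: "us \<in> H1u a b" "AE x in ?M. dvg a b us x = 0"
  proof -
    show "us \<in> H1u a b"
      unfolding us_def by (rule H1u_extrap(1)[OF u(2,3)])
    show "AE x in ?M. dvg a b us x = 0"
      unfolding us_def using H1u_extrap(2)[OF u(2,3)] div_free by eventually_elim simp
  qed
  have momentum: "1 / (2 * \<delta>t) * ip a b (bdf ut (u n) (u (n - 1))) ut + \<nu> * nsq a b (jac a b ut)
      + ip a b (grad a b (p n)) ut + ip a b (\<lambda>x. \<phi>s x *\<^sub>R grad a b \<mu>\<phi> x) ut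
      + ip a b (\<lambda>x. \<rho>s x *\<^sub>R grad a b \<mu>\<rho> x) ut = 0"
    using mom new(1) convection_skew[OF us new(1)]
    unfolding momentum_eq_def nsq_def ip_scaleR by (auto dest!: bspec)
  have projection: "1 / (2 * \<delta>t) * ip a b (bdf (u (n + 1)) (u n) (u (n - 1))) (u (n + 1))
      + \<delta>t / 3 * (nsq a b (grad a b (p (n + 1))) - nsq a b (grad a b (p n)))
    \<le> 1 / (2 * \<delta>t) * ip a b (bdf ut (u n) (u (n - 1))) ut + ip a b (grad a b (p n)) ut"
    using step2 div_free pres dt
    by (intro pressure_correction_energy u) (auto simp: bdf2_step2_def)
  note transport = transport_tested[OF tr(1) new(2)] transport_tested[OF tr(2) new(3)]
  have potentials: "ip a b \<mu>\<phi> (bdf (\<phi> (n + 1)) (\<phi> n) (\<phi> (n - 1))) + ip a b \<mu>\<rho> (bdf (\<rho> (n + 1)) (\<rho> n) (\<rho> (n - 1)))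
    = \<epsilon> * ip a b (bdf (grad a b (\<phi> (n + 1))) (grad a b (\<phi> n)) (grad a b (\<phi> (n - 1)))) (grad a b (\<phi> (n + 1)))
    + \<eta> * ip a b (bdf (grad a b (\<rho> (n + 1))) (grad a b (\<rho> n)) (grad a b (\<rho> (n - 1)))) (grad a b (\<rho> (n + 1)))
    + 1 / (2 * \<epsilon>) * ip a b (bdf (U (n + 1)) (U n) (U (n - 1))) (U (n + 1))
    + \<alpha> * ip a b (bdf (V (n + 1)) (V n) (V (n - 1))) (V (n + 1))
    + 2 * \<beta> * ip a b (bdf (W (n + 1)) (W n) (W (n - 1))) (W (n + 1))"
    (is "?potentials = ?bdf")
    using step1' by (intro chemical_potentials_tested[OF _ _ \<phi> \<rho> V]) auto
  have "\<epsilon> * (avg_sq a b (grad a b (\<phi> (n + 1))) (grad a b (\<phi> n)) - avg_sq a b (grad a b (\<phi> n)) (grad a b (\<phi> (n - 1))))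
    + \<eta> * (avg_sq a b (grad a b (\<rho> (n + 1))) (grad a b (\<rho> n)) - avg_sq a b (grad a b (\<rho> n)) (grad a b (\<rho> (n - 1))))
    + 1 / (2 * \<epsilon>) * (avg_sq a b (U (n + 1)) (U n) - avg_sq a b (U n) (U (n - 1)))
    + \<alpha> * (avg_sq a b (V (n + 1)) (V n) - avg_sq a b (V n) (V (n - 1)))
    + 2 * \<beta> * (avg_sq a b (W (n + 1)) (W n) - avg_sq a b (W n) (W (n - 1))) \<le> ?bdf" (is "?avg \<le> _")
    using params by (intro add_mono mult_left_mono avg_sq_diff_le U V W sq_int_grad \<phi> \<rho>) auto
  then have avg: "1 / (2 * \<delta>t) * ?avg \<le> 1 / (2 * \<delta>t) * ?bdf"
    using dt by (intro mult_left_mono) auto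
  have velocity: "1 / (2 * \<delta>t) * (avg_sq a b (u (n + 1)) (u n) - avg_sq a b (u n) (u (n - 1)))
    \<le> 1 / (2 * \<delta>t) * ip a b (bdf (u (n + 1)) (u n) (u (n - 1))) (u (n + 1))"
    using dt by (intro mult_left_mono avg_sq_diff_le sq_int_H1u u) auto
  have energy: "1 / \<delta>t * (E2nd a b \<epsilon> \<eta> \<alpha> \<beta> \<delta>t u p \<phi> \<rho> U V W (n + 1) n
                 - E2nd a b \<epsilon> \<eta> \<alpha> \<beta> \<delta>t u p \<phi> \<rho> U V W n (n - 1))
    = 1 / (2 * \<delta>t) * (avg_sq a b (u (n + 1)) (u n) - avg_sq a b (u n) (u (n - 1)))
      + \<delta>t / 3 * (nsq a b (grad a b (p (n + 1))) - nsq a b (grad a b (p n))) + 1 / (2 * \<delta>t) * ?avg"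
    using dt params by (simp add: E2nd_def field_simps power2_eq_square)
  have split: "1 / (2 * \<delta>t) * ?potentials
    = 1 / (2 * \<delta>t) * ip a b \<mu>\<phi> (bdf (\<phi> (n + 1)) (\<phi> n) (\<phi> (n - 1)))
      + 1 / (2 * \<delta>t) * ip a b \<mu>\<rho> (bdf (\<rho> (n + 1)) (\<rho> n) (\<rho> (n - 1)))"
    by (rule distrib_left)
  \<comment> \<open>A linear combination of the tested equations. It is stated for abstract reals to keep linear
    arithmetic from expanding the products inside them.\<close>
  have combine: "D \<le> - N - D1 - D2"
    if "kut + N + gp + T1 + T2 = 0" "ku + P \<le> kut + gp" "kf + D1 = T1" "kr + D2 = T2"
      "kp = kf + kr" "kavg \<le> kp" "kau \<le> ku" "D = kau + P + kavg"
    for D N D1 D2 kut gp T1 T2 ku P kf kr kp kavg kau :: real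
    using that by linarith
  show ?thesis
    using combine[OF momentum projection transport split avg[folded potentials] velocity energy] by simp
qed

end
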